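(* Let $M$ be a tame matroid (possibly infinite) and let $k$ be a finite field. Then $M$ is a thin sums matroid over $k$ if and only if every finite minor of $M$ is representable over $k$.
   Context: Matroids may be infinite, in the following sense: a matroid on a set $E$ is given by a family $\mathcal{I}\subseteq\mathcal{P}(E)$ of independent sets such that (I1) $\emptyset\in\mathcal{I}$; (I2) $\mathcal{I}$ is closed under subsets; (I3) whenever $I,I'\in\mathcal{I}$ with $I'$ maximal and $I$ not maximal, there is $x\in I'\setminus I$ with $I\cup\{x\}\in\mathcal{I}$; (IM) whenever $I\subseteq X\subseteq E$ and $I\in\mathcal{I}$, the set $\{I'\in\mathcal{I}\mid I\subseteq I'\subseteq X\}$ has a maximal element. Bases are maximal independent sets, circuits are minimal dependent sets; the dual $M^*$ has as bases the complements of bases of $M$, and cocircuits of $M$ are circuits of $M^*$. Deletion $M\backslash D$ has as independent sets the independent sets of $M$ disjoint from $D$; contraction is $M/C=(M^*\backslash C)^*$; minors are matroids $M/C\backslash D$ with $C,D$ disjoint; a minor is finite if its ground set is finite. A matroid is tame if every intersection of a circuit with a cocircuit is finite. A finite matroid is representable over $k$ if it is the matroid of linear independence of some family of vectors (indexed by its ground set) in a $k$-vector space. Thin sums matroids: let $A$ be a set and $f=(f_e\mid e\in E)$ a family of functions $A\to k$. A family $\lambda=(\lambda_e\mid e\in E)$ of elements of $k$ is a thin dependence of $f$ if for each $a\in A$ we have $\sum_{e\in E}\lambda_e f_e(a)=0$, where this includes the requirement that only finitely many summands are nonzero. A set $I\subseteq E$ is thinly independent for $f$ if the only thin dependence of $f$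 that is $0$ everywhere outside $I$ is the zero family. A matroid $M$ on $E$ is a thin sums matroid over $k$ if there are such $A$ and $f$ for which the independent sets of $M$ are precisely the thinly independent sets for $f$. *)

theory Defs
  imports Complex_Main "HOL-Library.Function_Algebras"
begin

section \<open>Possibly infinite matroids\<close>

text \<open>
  A value of the following type is only a set together with a family of sets; the matroid axioms
  are the predicate \<open>matroid\<close> below.
\<close>

datatype 'a indep_system = Indep_System (ground: "'a set") (indep: "'a set set")

definition maximal_in :: "'a set set \<Rightarrow> 'a set \<Rightarrow> bool" where
  "maximal_in S X \<longleftrightarrow> X \<in> S \<and> (\<forall>Y\<in>S. X \<subseteq> Y \<longrightarrow> Y = X)"

definition minimal_in :: "'a set set \<Rightarrow> 'a set \<Rightarrow> bool" where
  "minimal_in S X \<longleftrightarrow> X \<in> S \<and> (\<forall>Y\<in>S. Y \<subseteq> X \<longrightarrow> Y = X)"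

definition matroid :: "'a indep_system \<Rightarrow> bool" where
  "matroid M \<longleftrightarrow>
     indep M \<subseteq> Pow (ground M) \<and>
     {} \<in> indep M \<and>
     (\<forall>I J. I \<in> indep M \<and> J \<subseteq> I \<longrightarrow> J \<in> indep M) \<and>
     (\<forall>I I'. I \<in> indep M \<and> I' \<in> indep M \<and>
        maximal_in (indep M) I' \<and> \<not> maximal_in (indep M) I \<longrightarrow>
        (\<exists>x\<in>I' - I. insert x I \<in> indep M)) \<and>
     (\<forall>I X. I \<subseteq> X \<and> X \<subseteq> ground M \<and> I \<in> indep M \<longrightarrow>
        (\<exists>J. maximal_in {I'\<in>indep M. I \<subseteq> I' \<and> I' \<subseteq> X} J))"

definition base :: "'a indep_system \<Rightarrow> 'a set \<Rightarrow> bool" where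
  "base M B \<longleftrightarrow> maximal_in (indep M) B"

definition circuit :: "'a indep_system \<Rightarrow> 'a set \<Rightarrow> bool" where
  "circuit M C \<longleftrightarrow> minimal_in {X. X \<subseteq> ground M \<and> X \<notin> indep M} C"

text \<open>
  The dual is given by its independent sets, the subsets of complements of bases; see
  \<open>base_dual_iff\<close> below for the bases themselves.
\<close>

definition dual :: "'a indep_system \<Rightarrow> 'a indep_system" where
  "dual M = Indep_System (ground M) {I. \<exists>B. base M B \<and> I \<subseteq> ground M - B}"

definition cocircuit :: "'a indep_system \<Rightarrow> 'a set \<Rightarrow> bool" where
  "cocircuit M C \<longleftrightarrow> circuit (dual M) C"

definition deletion :: "'a indep_system \<Rightarrow> 'a set \<Rightarrow> 'a indep_system" where
  "deletion M D = Indep_System (ground M - D) {I\<in>indep M. I \<inter> D = {}}"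

definition contraction :: "'a indep_system \<Rightarrow> 'a set \<Rightarrow> 'a indep_system" where
  "contraction M C = dual (deletion (dual M) C)"

definition minor_of :: "'a indep_system \<Rightarrow> 'a indep_system \<Rightarrow> bool" where
  "minor_of N M \<longleftrightarrow>
     (\<exists>C D. C \<subseteq> ground M \<and> D \<subseteq> ground M \<and> C \<inter> D = {} \<and> N = deletion (contraction M C) D)"

definition tame :: "'a indep_system \<Rightarrow> bool" where
  "tame M \<longleftrightarrow> (\<forall>C D. circuit M C \<and> cocircuit M D \<longrightarrow> finite (C \<inter> D))"

lemma base_dual_iff:
  assumes "indep M \<subseteq> Pow (ground M)"
  shows "base (dual M) X \<longleftrightarrow> (\<exists>B. base M B \<and> X = ground M - B)"
proof
  assume "base (dual M) X"
  then have max: "maximal_in {I. \<exists>B. base M B \<and> I \<subseteq> ground M - B} X"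
    by (simp add: base_def[of "dual M"]) (simp add: dual_def)
  then obtain B where B: "base M B" "X \<subseteq> ground M - B"
    by (auto simp: maximal_in_def)
  with max have "ground M - B = X"
    unfolding maximal_in_def by blast
  with B(1) show "\<exists>B. base M B \<and> X = ground M - B" by blast
next
  assume "\<exists>B. base M B \<and> X = ground M - B"
  then obtain B where B: "base M B" "X = ground M - B" by blast
  have "Y = X" if "base M B'" "Y \<subseteq> ground M - B'" "X \<subseteq> Y" for Y B'
  proof -
    have "B' \<subseteq> B" using that B assms by (auto simp: base_def maximal_in_def)
    then have "B = B'" using that(1) B(1) by (auto simp: base_def maximal_in_def)
    then show ?thesis using that B by auto
  qed
  then have "maximal_in {I. \<exists>B. base M B \<and> I \<subseteq> ground M - B} X"
    using B by (auto simp: maximal_in_def)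
  then show "base (dual M) X"
    by (simp add: base_def[of "dual M"]) (simp add: dual_def)
qed


section \<open>Representability of finite matroids\<close>

text \<open>
  Linear independence of a family, as opposed to that of its set of values: repeated vectors make
  a family dependent.
\<close>

definition linindep_family ::
    "('k::field \<Rightarrow> 'v \<Rightarrow> 'v::ab_group_add) \<Rightarrow> ('a \<Rightarrow> 'v) \<Rightarrow> 'a set \<Rightarrow> bool" where
  "linindep_family scale v I \<longleftrightarrow> inj_on v I \<and> \<not> module.dependent scale (v ` I)"

definition represents ::
    "('k::field \<Rightarrow> 'v \<Rightarrow> 'v::ab_group_add) \<Rightarrow> ('a \<Rightarrow> 'v) \<Rightarrow> 'a indep_system \<Rightarrow> bool" where
  "represents scale v M \<longleftrightarrow> indep M = {I. I \<subseteq> ground M \<and> linindep_family scale v I}"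

definition fun_scale :: "'k::field \<Rightarrow> ('i \<Rightarrow> 'k) \<Rightarrow> ('i \<Rightarrow> 'k)" where
  "fun_scale c x = (\<lambda>i. c * x i)"

text \<open>
  HOL cannot quantify existentially over the type of a vector space. As only finite matroids
  matter here, the space of all sequences over the field is large enough: by
  \<open>representableI\<close> below, a representation of a finite matroid in any vector space over the field
  gives one in this space.
\<close>

definition representable :: "'k::field itself \<Rightarrow> 'a indep_system \<Rightarrow> bool" where
  "representable K M \<longleftrightarrow>
     (\<exists>v :: 'a \<Rightarrow> nat \<Rightarrow> 'k. represents fun_scale v M)"

lemma vector_space_fun_scale: "vector_space (fun_scale :: 'k::field \<Rightarrow> ('i \<Rightarrow> 'k) \<Rightarrow> _)"
  by standard (auto simp: fun_scale_def algebra_simps)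

lemma linindep_family_iff:
  fixes scale :: "'k::field \<Rightarrow> 'v::ab_group_add \<Rightarrow> 'v"
  assumes "vector_space scale" and fin: "finite I"
  shows "linindep_family scale v I \<longleftrightarrow>
    (\<forall>c. (\<Sum>e\<in>I. scale (c e) (v e)) = 0 \<longrightarrow> (\<forall>e\<in>I. c e = 0))" (is "_ = ?R")
proof -
  interpret vector_space scale by fact
  show ?thesis
  proof
    assume L: "linindep_family scale v I"
    then have inj: "inj_on v I" and ind: "independent (v ` I)"
      by (auto simp: linindep_family_def)
    show ?R
    proof (intro allI impI ballI)
      fix c e assume s: "(\<Sum>e\<in>I. scale (c e) (v e)) = 0" and e: "e \<in> I"
      have "(\<Sum>x\<in>v ` I. scale (c (inv_into I v x)) x) = (\<Sum>e\<in>I. scale (c e) (v e))"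
        by (simp add: sum.reindex[OF inj] inj)
      then have "c (inv_into I v (v e)) = 0"
        using independentD[OF ind, of "v ` I" "\<lambda>x. c (inv_into I v x)" "v e"] s e fin by simp
      then show "c e = 0" using inj e by simp
    qed
  next
    assume R: ?R
    have inj: "inj_on v I"
    proof (rule inj_onI, rule ccontr)
      fix a b assume ab: "a \<in> I" "b \<in> I" "v a = v b" "a \<noteq> b"
      let ?c = "\<lambda>e. if e = a then 1 else if e = b then - 1 else (0 :: 'k)"
      have "(\<Sum>e\<in>I. scale (?c e) (v e)) = (\<Sum>e\<in>{a, b}. scale (?c e) (v e))"
        using ab fin by (intro sum.mono_neutral_right) auto
      also have "\<dots> = 0" using ab by simp
      finally have "\<forall>e\<in>I. ?c e = 0" using spec[OF R, of ?c] by (rule rev_mp)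
      then have "?c a = 0" using ab(1) by blast
      then show False by simp
    qed
    have "independent (v ` I)"
    proof
      assume "dependent (v ` I)"
      then obtain u where u: "\<exists>x\<in>v ` I. u x \<noteq> 0" "(\<Sum>x\<in>v ` I. scale (u x) x) = 0"
        using fin by (auto simp: dependent_finite)
      then have "(\<Sum>e\<in>I. scale (u (v e)) (v e)) = 0"
        by (simp add: sum.reindex[OF inj])
      then have "\<forall>e\<in>I. u (v e) = 0" using R by (elim allE[of _ "u \<circ> v"]) simp
      with u show False by auto
    qed
    with inj show "linindep_family scale v I" by (simp add: linindep_family_def)
  qed
qed

lemma representableI:
  fixes scale :: "'k::field \<Rightarrow> 'v::ab_group_add \<Rightarrow> 'v" and v :: "'a \<Rightarrow> 'v"
  assumes vs: "vector_space scale" and fin: "finite (ground M)" and rep: "represents scale v M"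
  shows "representable TYPE('k) M"
proof -
  interpret vector_space scale by fact
  obtain B where B: "B \<subseteq> v ` ground M" "independent B" "v ` ground M \<subseteq> span B"
    by (rule maximal_independent_subset)
  have finB: "finite B" using B(1) fin finite_subset by blast
  then obtain b :: "nat \<Rightarrow> 'v" and n where b: "b ` {..<n} = B"
    by (metis finite_imp_nat_seg_image_inj_on lessThan_def)
  define w where "w e i = (if i < n then representation B (v e) (b i) else 0)" for e i
  have eq: "linindep_family scale v I \<longleftrightarrow> linindep_family fun_scale w I" if I: "I \<subseteq> ground M" for I
  proof -
    have finI: "finite I" using I fin finite_subset by blast
    have "(\<Sum>e\<in>I. scale (c e) (v e)) = 0 \<longleftrightarrow> (\<Sum>e\<in>I. fun_scale (c e) (w e)) = 0" for c
    proof -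
      let ?s = "\<Sum>e\<in>I. scale (c e) (v e)"
      have sp: "v e \<in> span B" if "e \<in> I" for e using that I B(3) by blast
      have s: "?s \<in> span B" by (intro span_sum span_scale sp)
      have r: "representation B ?s x = (\<Sum>e\<in>I. c e * representation B (v e) x)" for x
        using sp by (simp add: representation_sum[OF B(2)] representation_scale[OF B(2)] span_scale)
      have app: "(\<Sum>e\<in>I. fun_scale (c e) (w e)) i = (\<Sum>e\<in>I. c e * w e i)" for i
        using finI by (induction I rule: finite_induct) (auto simp: fun_scale_def)
      have "?s = 0 \<longleftrightarrow> (\<forall>x\<in>B. representation B ?s x = 0)"
        using sum_representation_eq[OF B(2) s finB order_refl]
        by (auto simp: representation_zero)
      also have "\<dots> \<longleftrightarrow> (\<forall>i<n. (\<Sum>e\<in>I. c e * w e i) = 0)"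
      proof -
        have "(\<forall>x\<in>B. P x) \<longleftrightarrow> (\<forall>i<n. P (b i))" for P using b by auto
        then show ?thesis by (simp add: r w_def)
      qed
      also have "\<dots> \<longleftrightarrow> (\<Sum>e\<in>I. fun_scale (c e) (w e)) = 0"
      proof -
        have "(\<Sum>e\<in>I. c e * w e i) = 0" if "\<not> i < n" for i using that by (simp add: w_def)
        then show ?thesis by (auto simp: fun_eq_iff app)
      qed
      finally show ?thesis .
    qed
    then show ?thesis
      by (simp add: linindep_family_iff[OF vs finI]
          linindep_family_iff[OF vector_space_fun_scale finI])
  qed
  have "represents fun_scale w M"
    using rep eq by (auto simp: represents_def)
  then show ?thesis by (auto simp: representable_def)
qed


section \<open>Thin sums matroids\<close>

definition thin_dependence ::
    "'a set \<Rightarrow> 'b set \<Rightarrow> ('a \<Rightarrow> 'b \<Rightarrow> 'k::field) \<Rightarrow> ('a \<Rightarrow> 'k) \<Rightarrow> bool" where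
  "thin_dependence E A f l \<longleftrightarrow>
     (\<forall>a\<in>A. finite {e\<in>E. l e * f e a \<noteq> 0} \<and> (\<Sum>e | e \<in> E \<and> l e * f e a \<noteq> 0. l e * f e a) = 0)"

definition thin_indep ::
    "'a set \<Rightarrow> 'b set \<Rightarrow> ('a \<Rightarrow> 'b \<Rightarrow> 'k::field) \<Rightarrow> 'a set \<Rightarrow> bool" where
  "thin_indep E A f I \<longleftrightarrow>
     (\<forall>l. thin_dependence E A f l \<and> (\<forall>e\<in>E - I. l e = 0) \<longrightarrow> (\<forall>e\<in>E. l e = 0))"

text \<open>
  The index set is taken from the type of functions from the ground type to the field, which
  is large enough: by \<open>thin_sums_matroidI\<close> below, an index set of any type will do.
\<close>

definition thin_sums_matroid :: "'k::field itself \<Rightarrow> 'a indep_system \<Rightarrow> bool" where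
  "thin_sums_matroid K M \<longleftrightarrow> matroid M \<and>
     (\<exists>(A :: ('a \<Rightarrow> 'k) set) (f :: 'a \<Rightarrow> ('a \<Rightarrow> 'k) \<Rightarrow> 'k).
        indep M = {I. I \<subseteq> ground M \<and> thin_indep (ground M) A f I})"

lemma thin_sums_matroidI:
  fixes A :: "'b set" and f :: "'a \<Rightarrow> 'b \<Rightarrow> 'k::field"
  assumes "matroid M" and "indep M = {I. I \<subseteq> ground M \<and> thin_indep (ground M) A f I}"
  shows "thin_sums_matroid TYPE('k) M"
proof -
  have "thin_dependence (ground M) ((\<lambda>a e. f e a) ` A) (\<lambda>e g. g e) = thin_dependence (ground M) A f"
    by (auto simp: thin_dependence_def fun_eq_iff)
  then have "thin_indep (ground M) ((\<lambda>a e. f e a) ` A) (\<lambda>e g. g e) = thin_indep (ground M) A f"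
    by (simp add: thin_indep_def fun_eq_iff)
  with assms show ?thesis
    unfolding thin_sums_matroid_def by metis
qed

end

theory Submission
  imports Defs "HOL-Analysis.Function_Topology"
begin

text \<open>
  Both conditions are equivalent to the existence of nonzero weights \<open>c C e\<close> for \<open>e\<close> in a circuit
  \<open>C\<close> and \<open>d D e\<close> for \<open>e\<close> in a cocircuit \<open>D\<close> such that \<open>c C\<close> and \<open>d D\<close> are always orthogonal on the
  finite set \<open>C \<inter> D\<close>. The vectors \<open>d D\<close> serve as equations of a thin sums representation and, for
  \<open>D\<close> avoiding the contracted set, as coordinates of a representation of a finite minor. Weights are
  obtained from a thin sums representation by taking thin dependences supported on circuits and
  eliminating along circuits that meet \<open>D\<close> in two elements. From representations of the finite
  minors they come by compactness: finitely many circuits and cocircuits are all visible in a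
  single finite minor, and the field is finite.
\<close>

section \<open>Circuits and cocircuits\<close>

text \<open>Orthogonality to a circuit \<open>C\<close> with \<open>C \<inter> D = {e, x}\<close>
  fixes the ratio of \<open>d D x\<close> to \<open>d D e\<close>. The weights on \<open>D\<close>
  are thus forced up to a scalar, and the real task is consistency with every other circuit.
  Tameness makes this a finite elimination, which leaves a thin dependence whose support meets
  \<open>D\<close> in at most one element. That support may be infinite and shows no circuit through
  the element; clearing it directly would need a sum of infinitely many thin dependences, which may
  be meaningless. A limit over the finite field takes the place of that sum, so compactness serves
  both directions. Tameness also makes every orthogonality condition depend on finitely many
  weights, hence closed. All arguments run inside \<open>M\<close>: cocircuits are treated as the
  minimal sets meeting every base, and minors through the circuits and cocircuits of
  \<open>M\<close>.\<close>

context
  fixes M :: "'a indep_system"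
  assumes M: "matroid M"
begin

lemma indep_ground: "I \<in> indep M \<Longrightarrow> I \<subseteq> ground M"
  using M by (auto simp: matroid_def)

lemma indep_empty: "{} \<in> indep M"
  using M by (auto simp: matroid_def)

lemma indep_mono: "I \<in> indep M \<Longrightarrow> J \<subseteq> I \<Longrightarrow> J \<in> indep M"
  using M unfolding matroid_def by blast

lemma base_augment:
  assumes "base M B" "I \<in> indep M" "\<not> base M I"
  obtains x where "x \<in> B - I" "insert x I \<in> indep M"
proof -
  have "\<forall>I I'. I \<in> indep M \<and> I' \<in> indep M \<and> maximal_in (indep M) I' \<and> \<not> maximal_in (indep M) I \<longrightarrow>
      (\<exists>x\<in>I' - I. insert x I \<in> indep M)"
    using M unfolding matroid_def by (elim conjE) assumption
  moreover have "B \<in> indep M" using assms(1) by (simp add: base_def maximal_in_def)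
  ultimately have "\<exists>x\<in>B - I. insert x I \<in> indep M" using assms by (simp add: base_def)
  with that show ?thesis by blast
qed

lemma maximal_between:
  assumes "I \<in> indep M" "I \<subseteq> X" "X \<subseteq> ground M"
  obtains J where "J \<in> indep M" "I \<subseteq> J" "J \<subseteq> X"
    "\<And>x. x \<in> X - J \<Longrightarrow> insert x J \<notin> indep M"
proof -
  have "\<forall>I X. I \<subseteq> X \<and> X \<subseteq> ground M \<and> I \<in> indep M \<longrightarrow>
      (\<exists>J. maximal_in {I'\<in>indep M. I \<subseteq> I' \<and> I' \<subseteq> X} J)"
    using M unfolding matroid_def by (elim conjE) assumption
  with assms obtain J where "maximal_in {I'\<in>indep M. I \<subseteq> I' \<and> I' \<subseteq> X} J"
    by presburger
  then have J: "J \<in> indep M" "I \<subseteq> J" "J \<subseteq> X"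
    and max: "\<And>K. K \<in> indep M \<Longrightarrow> I \<subseteq> K \<Longrightarrow> K \<subseteq> X \<Longrightarrow> J \<subseteq> K \<Longrightarrow> K = J"
    by (auto simp: maximal_in_def)
  have "insert x J \<notin> indep M" if "x \<in> X - J" for x
    using max[of "insert x J"] J that by auto
  with J that show ?thesis by blast
qed

lemma baseI:
  assumes "B \<in> indep M" "\<And>x. x \<in> ground M - B \<Longrightarrow> insert x B \<notin> indep M"
  shows "base M B"
proof -
  have "Y = B" if Y: "Y \<in> indep M" "B \<subseteq> Y" for Y
  proof (rule ccontr)
    assume "Y \<noteq> B"
    then obtain x where "x \<in> Y - B" using Y by blast
    with Y assms(2)[of x] indep_ground[of Y] indep_mono[of Y "insert x B"] show False by auto
  qed
  with assms(1) show ?thesis by (auto simp: base_def maximal_in_def)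
qed

lemma base_indep: "base M B \<Longrightarrow> B \<in> indep M"
  by (auto simp: base_def maximal_in_def)

lemma base_insert: "base M B \<Longrightarrow> x \<notin> B \<Longrightarrow> insert x B \<notin> indep M"
  unfolding base_def maximal_in_def by blast

lemma base_subset_eq: "base M B \<Longrightarrow> base M B' \<Longrightarrow> B \<subseteq> B' \<Longrightarrow> B' = B"
  unfolding base_def maximal_in_def by blast

text \<open>(IM) and (I3) combine here: a maximal independent set between \<open>I\<close> and
  \<open>I \<union> B\<close> that were not a base could be augmented from \<open>B\<close>.\<close>

lemma indep_extend_base:
  assumes "I \<in> indep M" "base M B"
  obtains B' where "base M B'" "I \<subseteq> B'" "B' \<subseteq> I \<union> B"
proof -
  obtain J where J: "J \<in> indep M" "I \<subseteq> J" "J \<subseteq> I \<union> B"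
    "\<And>x. x \<in> I \<union> B - J \<Longrightarrow> insert x J \<notin> indep M"
    by (rule maximal_between[of I "I \<union> B"])
      (use assms(1) indep_ground[OF assms(1)] indep_ground[OF base_indep[OF assms(2)]] in auto)
  have "base M J"
  proof (rule ccontr)
    assume "\<not> base M J"
    then obtain x where "x \<in> B - J" "insert x J \<in> indep M"
      using base_augment assms(2) J(1) by blast
    with J(4) show False by blast
  qed
  with J that show ?thesis by blast
qed

lemma base_exists: obtains B where "base M B"
proof -
  obtain J where "J \<in> indep M" "\<And>x. x \<in> ground M - J \<Longrightarrow> insert x J \<notin> indep M"
    by (rule maximal_between[of "{}" "ground M"]) (auto simp: indep_empty)
  then have "base M J" by (rule baseI)
  with that show ?thesis .
qed

lemma indep_base:
  assumes "I \<in> indep M"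
  obtains B where "base M B" "I \<subseteq> B"
proof -
  obtain B0 where "base M B0" by (rule base_exists)
  with assms obtain B where "base M B" "I \<subseteq> B" by (rule indep_extend_base)
  with that show ?thesis .
qed

text \<open>Axiom (I3) for the restriction of the matroid to \<open>X\<close>.\<close>

lemma augment_within:
  assumes I': "I' \<in> indep M" "I' \<subseteq> X" and max: "\<And>x. x \<in> X - I' \<Longrightarrow> insert x I' \<notin> indep M"
    and I: "I \<in> indep M" "I \<subseteq> X" and y: "y \<in> X - I" "insert y I \<in> indep M"
  obtains x where "x \<in> I' - I" "insert x I \<in> indep M"
proof (rule ccontr)
  assume no: "\<not> thesis"
  obtain B' where B': "base M B'" "I' \<subseteq> B'" using I'(1) indep_base by blast
  obtain B where B: "base M B" "I \<subseteq> B" "B \<subseteq> I \<union> B'" using I(1) B'(1) indep_extend_base by blast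
  have B'X: "B' \<inter> X \<subseteq> I'"
  proof
    fix z assume z: "z \<in> B' \<inter> X"
    then have "insert z I' \<in> indep M" by (intro indep_mono[OF base_indep[OF B'(1)]]) (use B'(2) in blast)
    then show "z \<in> I'" using max z by blast
  qed
  have BX: "B \<inter> X \<subseteq> I"
  proof
    fix z assume z: "z \<in> B \<inter> X"
    show "z \<in> I"
    proof (rule ccontr)
      assume "z \<notin> I"
      with z B B'X have "z \<in> I' - I" by blast
      moreover have "insert z I \<in> indep M" by (rule indep_mono[OF base_indep[OF B(1)]]) (use B(2) z in blast)
      ultimately show False using no that by blast
    qed
  qed
  obtain B2 where B2: "base M B2" "insert y I \<subseteq> B2" "B2 \<subseteq> insert y I \<union> B"
    using y(2) B(1) indep_extend_base by blast
  have "y \<notin> B" using BX y by blast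
  then have "\<not> B \<subseteq> B2" using base_subset_eq[OF B(1) B2(1)] B2 by blast
  then obtain z where z: "z \<in> B" "z \<notin> B2" by blast
  then have zz: "z \<in> B' - X" using B B2 BX by blast
  \<comment> \<open>\<open>B2 - X\<close> lies in \<open>B'\<close>, so \<open>?K\<close> is
    independent, and it misses \<open>z\<close>, so it is not a base. Whatever augments it from
    \<open>B2\<close> must lie in \<open>X\<close>, against the maximality of
    \<open>I'\<close>.\<close>
  let ?K = "I' \<union> (B2 - X)"
  have K: "?K \<subseteq> B' - {z}" using B B2 B'(2) y I I' z zz by blast
  then have Ki: "?K \<in> indep M" using indep_mono base_indep[OF B'(1)] by blast
  have "\<not> base M ?K" using base_subset_eq[OF _ B'(1), of ?K] K zz by blast
  then obtain w where w: "w \<in> B2 - ?K" "insert w ?K \<in> indep M"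
    using base_augment[OF B2(1) Ki] by blast
  then have "w \<in> X - I'" by blast
  moreover have "insert w I' \<in> indep M" by (rule indep_mono[OF w(2)]) blast
  ultimately show False using max by blast
qed

lemma circuitD:
  assumes "circuit M C"
  shows "C \<subseteq> ground M" "C \<notin> indep M" "\<And>e. e \<in> C \<Longrightarrow> C - {e} \<in> indep M"
proof -
  have *: "C \<subseteq> ground M" "C \<notin> indep M" "\<And>Y. Y \<subseteq> ground M \<Longrightarrow> Y \<notin> indep M \<Longrightarrow> Y \<subseteq> C \<Longrightarrow> Y = C"
    using assms by (auto simp: circuit_def minimal_in_def)
  show "C \<subseteq> ground M" "C \<notin> indep M" by fact+
  show "C - {e} \<in> indep M" if "e \<in> C" for e
    using *(1) *(3)[of "C - {e}"] that by blast
qed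

lemma circuitI:
  assumes "C \<subseteq> ground M" "C \<notin> indep M" "\<And>e. e \<in> C \<Longrightarrow> C - {e} \<in> indep M"
  shows "circuit M C"
  unfolding circuit_def minimal_in_def
proof (intro conjI ballI impI)
  show "C \<in> {X. X \<subseteq> ground M \<and> X \<notin> indep M}" using assms by blast
  fix Y assume Y: "Y \<in> {X. X \<subseteq> ground M \<and> X \<notin> indep M}" "Y \<subseteq> C"
  show "Y = C"
  proof (rule ccontr)
    assume "Y \<noteq> C"
    then obtain e where "e \<in> C" "Y \<subseteq> C - {e}" using Y by blast
    with Y assms(3) indep_mono show False by blast
  qed
qed

text \<open>A chain of dependent sets may have an independent intersection, so Zorn's lemma gives no
  minimal dependent set. Instead a circuit is written down inside a set that exceeds an independent
  one by a single element.\<close>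

lemma dependent_contains_circuit:
  assumes X: "X \<subseteq> ground M" "X \<notin> indep M"
  obtains C where "circuit M C" "C \<subseteq> X"
proof -
  obtain I where I: "I \<in> indep M" "I \<subseteq> X" "\<And>x. x \<in> X - I \<Longrightarrow> insert x I \<notin> indep M"
    by (rule maximal_between[of "{}" X]) (auto simp: indep_empty X)
  have "I \<noteq> X" using I(1) X(2) by blast
  then obtain x where x: "x \<in> X - I" using I(2) by blast
  let ?X = "insert x I"
  \<comment> \<open>Every circuit inside \<open>?X\<close> must contain each such \<open>y\<close>,
    so this is the only candidate; what needs proof is that it is large enough to be
    dependent.\<close>
  define C where "C = {y \<in> ?X. ?X - {y} \<in> indep M}"
  have X': "?X \<notin> indep M" "?X \<subseteq> X" using I x by blast+
  have xC: "x \<in> C" using x I(1) by (simp add: C_def)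
  have "C \<notin> indep M"
  proof
    assume "C \<in> indep M"
    then obtain J where J: "J \<in> indep M" "C \<subseteq> J" "J \<subseteq> ?X"
      "\<And>z. z \<in> ?X - J \<Longrightarrow> insert z J \<notin> indep M"
      by (rule maximal_between[of C ?X]) (use X X'(2) in \<open>auto simp: C_def\<close>)
    from J(1) X'(1) have "J \<noteq> ?X" by blast
    then obtain y where y: "y \<in> ?X - J" using J(3) by blast
    have yI: "y \<in> I" "y \<noteq> x" "y \<notin> C" using y xC J by blast+
    then have dep: "?X - {y} \<notin> indep M" by (auto simp: C_def)
    have 1: "I - {y} \<in> indep M" "insert y (I - {y}) \<in> indep M"
      using I(1) yI indep_mono[of I "I - {y}"] by (auto simp: insert_absorb)
    obtain w where w: "w \<in> J - (I - {y})" "insert w (I - {y}) \<in> indep M"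
      using augment_within[OF J(1,3,4), of "I - {y}" y] 1 yI by blast
    have "w = x" using w y J by blast
    then have "insert w (I - {y}) = ?X - {y}" using yI by blast
    with w dep show False by simp
  qed
  moreover have "C - {y} \<in> indep M" if "y \<in> C" for y
    using that indep_mono[of "?X - {y}" "C - {y}"] by (auto simp: C_def)
  moreover have "C \<subseteq> X" using X'(2) by (auto simp: C_def)
  ultimately show ?thesis using circuitI[of C] X(1) that[of C] by blast
qed

lemma fundamental_circuit:
  assumes "I \<in> indep M" "insert x I \<notin> indep M" "x \<in> ground M"
  obtains C where "circuit M C" "x \<in> C" "C \<subseteq> insert x I"
proof -
  obtain C where C: "circuit M C" "C \<subseteq> insert x I"
    using dependent_contains_circuit[of "insert x I"] assms indep_ground by auto
  moreover have "x \<in> C"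
  proof (rule ccontr)
    assume "x \<notin> C"
    then have "C \<subseteq> I" using C by blast
    then show False using assms(1) indep_mono circuitD(2)[OF C(1)] by blast
  qed
  ultimately show ?thesis using that by blast
qed

section \<open>Cocircuits as minimal sets meeting every base, and their intersections with
  circuits\<close>

lemma cocircuitD:
  assumes "cocircuit M D"
  shows "D \<subseteq> ground M" "\<And>B. base M B \<Longrightarrow> B \<inter> D \<noteq> {}"
    "\<And>e. e \<in> D \<Longrightarrow> \<exists>B. base M B \<and> B \<inter> D = {e}"
proof -
  have *: "D \<subseteq> ground M" "\<And>B. base M B \<Longrightarrow> \<not> D \<subseteq> ground M - B"
    "\<And>Y. Y \<subseteq> ground M \<Longrightarrow> (\<And>B. base M B \<Longrightarrow> \<not> Y \<subseteq> ground M - B) \<Longrightarrow> Y \<subseteq> D \<Longrightarrow> Y = D"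
    using assms by (auto simp: cocircuit_def circuit_def minimal_in_def dual_def)
  show "D \<subseteq> ground M" by fact
  show 2: "B \<inter> D \<noteq> {}" if "base M B" for B using *(1) *(2)[OF that] by blast
  show "\<exists>B. base M B \<and> B \<inter> D = {e}" if e: "e \<in> D" for e
  proof -
    obtain B where "base M B" "D - {e} \<subseteq> ground M - B"
      using *(1) *(3)[of "D - {e}"] e by blast
    with 2 show ?thesis by blast
  qed
qed

lemma cocircuitI:
  assumes "D \<subseteq> ground M" "\<And>B. base M B \<Longrightarrow> B \<inter> D \<noteq> {}"
    "\<And>e. e \<in> D \<Longrightarrow> \<exists>B. base M B \<and> B \<inter> D \<subseteq> {e}"
  shows "cocircuit M D"
  unfolding cocircuit_def circuit_def minimal_in_def
proof (intro conjI ballI impI)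
  show "D \<in> {X. X \<subseteq> ground (dual M) \<and> X \<notin> indep (dual M)}"
    using assms(1,2) by (auto simp: dual_def)
  fix Y assume Y: "Y \<in> {X. X \<subseteq> ground (dual M) \<and> X \<notin> indep (dual M)}" "Y \<subseteq> D"
  show "Y = D"
  proof (rule ccontr)
    assume "Y \<noteq> D"
    then obtain e where "e \<in> D" "e \<notin> Y" using Y by blast
    with assms(3) Y obtain B where "base M B" "B \<inter> Y = {}" by blast
    with Y show False by (auto simp: dual_def)
  qed
qed

lemma circuit_nonempty: "circuit M C \<Longrightarrow> C \<noteq> {}"
  using circuitD(2) indep_empty by blast

lemma cocircuit_nonempty: "cocircuit M D \<Longrightarrow> D \<noteq> {}"
  using cocircuitD(2) base_exists by blast

text \<open>Otherwise \<open>C - {e}\<close> avoids \<open>D\<close>. Extended to a maximal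
  independent set avoiding \<open>D\<close>, it is still not a base; an augmentation from a base
  that meets \<open>D\<close> only in \<open>e\<close> must add \<open>e\<close> and so complete
  \<open>C\<close>.\<close>

lemma circuit_cocircuit_Int:
  assumes C: "circuit M C" and D: "cocircuit M D"
  shows "C \<inter> D \<noteq> {e}"
proof
  assume CD: "C \<inter> D = {e}"
  have e: "e \<in> C" "e \<in> D" using CD by auto
  have "C - {e} \<subseteq> ground M - D" using CD circuitD(1)[OF C] by auto
  with circuitD(3)[OF C e(1)] obtain K where K: "K \<in> indep M" "C - {e} \<subseteq> K" "K \<subseteq> ground M - D"
    "\<And>x. x \<in> ground M - D - K \<Longrightarrow> insert x K \<notin> indep M"
    by (rule maximal_between) auto
  obtain B where B: "base M B" "B \<inter> D = {e}" using cocircuitD(3)[OF D e(2)] by blast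
  have "\<not> base M K" using cocircuitD(2)[OF D] K by blast
  then obtain w where w: "w \<in> B - K" "insert w K \<in> indep M" using base_augment[OF B(1) K(1)] by blast
  then have "w \<in> D" using K(4)[of w] indep_ground[of "insert w K"] by blast
  then have "w = e" using w(1) B(2) by blast
  then have "C \<subseteq> insert w K" using K(2) by blast
  then show False using circuitD(2)[OF C] indep_mono[OF w(2)] by simp
qed

lemma fundamental_cocircuit:
  assumes B: "base M B" and e: "e \<in> B"
  obtains D where "cocircuit M D" "D \<inter> B = {e}"
proof
  \<comment> \<open>The elements that can stand in for \<open>e\<close> in \<open>B\<close>: any
    base must supply one of them to repair \<open>B - {e}\<close>.\<close>
  let ?D = "insert e {y \<in> ground M - B. insert y (B - {e}) \<in> indep M}"
  show "?D \<inter> B = {e}" using e by blast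
  have Bi: "B - {e} \<in> indep M" using indep_mono base_indep[OF B] by blast
  show "cocircuit M ?D"
  proof (rule cocircuitI)
    show "?D \<subseteq> ground M" using indep_ground[OF base_indep[OF B]] e by blast
  next
    fix B' assume B': "base M B'"
    have "\<not> base M (B - {e})" using base_subset_eq[OF _ B, of "B - {e}"] e by blast
    then obtain w where w: "w \<in> B' - (B - {e})" "insert w (B - {e}) \<in> indep M"
      using base_augment[OF B' Bi] by blast
    then have "w \<in> ?D" using indep_ground[OF w(2)] by blast
    then show "B' \<inter> ?D \<noteq> {}" using w by blast
  next
    fix y assume y: "y \<in> ?D"
    show "\<exists>B. base M B \<and> B \<inter> ?D \<subseteq> {y}"
    proof (cases "y = e")
      case True
      then show ?thesis using B by blast
    next
      case False
      let ?B = "insert y (B - {e})"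
      have y': "y \<notin> B" "?B \<in> indep M" using y False by blast+
      have "base M ?B"
      proof (rule ccontr)
        assume "\<not> base M ?B"
        then obtain w where w: "w \<in> B - ?B" "insert w ?B \<in> indep M"
          using base_augment[OF B y'(2)] by blast
        then have "insert w ?B = insert y B" by blast
        with w base_insert[OF B y'(1)] show False by simp
      qed
      moreover have "?B \<inter> ?D \<subseteq> {y}" by blast
      ultimately show ?thesis by blast
    qed
  qed
qed

text \<open>In a base containing \<open>C - {e}\<close>, the fundamental cocircuit of
  \<open>f\<close> can meet \<open>C\<close> only in \<open>e\<close> and \<open>f\<close>, and it
  cannot meet it in \<open>f\<close> alone.\<close>

lemma cocircuit_through_two:
  assumes C: "circuit M C" and ef: "e \<in> C" "f \<in> C" "e \<noteq> f"
  obtains D where "cocircuit M D" "C \<inter> D = {e, f}"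
proof -
  obtain B where B: "base M B" "C - {e} \<subseteq> B" using indep_base circuitD(3)[OF C ef(1)] by blast
  obtain D where D: "cocircuit M D" "D \<inter> B = {f}" using fundamental_cocircuit[OF B(1)] B ef by blast
  have "C \<inter> D \<subseteq> {e, f}" "f \<in> C \<inter> D" using B(2) D(2) ef by auto
  moreover have "C \<inter> D \<noteq> {f}" using circuit_cocircuit_Int[OF C D(1)] .
  ultimately have "C \<inter> D = {e, f}" by blast
  with D that show ?thesis by blast
qed

text \<open>The dual argument: the fundamental circuit of \<open>f\<close> over a base that meets
  \<open>D\<close> only in \<open>e\<close>.\<close>

lemma circuit_through_two:
  assumes D: "cocircuit M D" and ef: "e \<in> D" "f \<in> D" "e \<noteq> f"
  obtains C where "circuit M C" "C \<inter> D = {e, f}"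
proof -
  obtain B where B: "base M B" "B \<inter> D = {e}" using cocircuitD(3)[OF D ef(1)] by blast
  have f: "f \<notin> B" "f \<in> ground M" using B(2) ef cocircuitD(1)[OF D] by auto
  obtain C where C: "circuit M C" "f \<in> C" "C \<subseteq> insert f B"
    using fundamental_circuit[OF base_indep[OF B(1)] base_insert[OF B(1) f(1)] f(2)] by blast
  have "C \<inter> D \<subseteq> {e, f}" "f \<in> C \<inter> D" using B(2) C(2,3) ef by auto
  moreover have "C \<inter> D \<noteq> {f}" using circuit_cocircuit_Int[OF C(1) D] .
  ultimately have "C \<inter> D = {e, f}" by blast
  with C that show ?thesis by blast
qed

end

section \<open>Contraction\<close>

context
  fixes M :: "'a indep_system"
  assumes M: "matroid M"
begin

text \<open>Complementation turns maximality in the deleted dual into minimality of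
  \<open>B - P\<close>.\<close>

lemma base_deletion_dual_iff:
  "base (deletion (dual M) P) K \<longleftrightarrow>
    (\<exists>B. base M B \<and> K = ground M - P - B \<and> (\<forall>B'. base M B' \<longrightarrow> B' - P \<subseteq> B - P \<longrightarrow> B' - P = B - P))"
proof -
  let ?S = "{I. (\<exists>B. base M B \<and> I \<subseteq> ground M - B) \<and> I \<inter> P = {}}"
  have S: "base (deletion (dual M) P) K \<longleftrightarrow> maximal_in ?S K"
    by (subst base_def) (simp add: deletion_def dual_def)
  have G: "B \<subseteq> ground M" if "base M B" for B
    using indep_ground[OF M base_indep[OF M that]] .
  show ?thesis
  proof
    assume "base (deletion (dual M) P) K"
    then have K: "K \<in> ?S" "\<And>Y. Y \<in> ?S \<Longrightarrow> K \<subseteq> Y \<Longrightarrow> Y = K"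
      by (auto simp only: S maximal_in_def)
    then obtain B where B: "base M B" "K \<subseteq> ground M - B" "K \<inter> P = {}" by blast
    have eq: "ground M - P - B = K" by (rule K(2)) (use B in blast)+
    have "B' - P = B - P" if B': "base M B'" "B' - P \<subseteq> B - P" for B'
    proof -
      have "ground M - P - B' = K" by (rule K(2)) (use B' eq in blast)+
      then have "B - P \<subseteq> B' - P" using eq G[OF B(1)] by auto
      with B' show ?thesis by (intro equalityI)
    qed
    with B eq show "\<exists>B. base M B \<and> K = ground M - P - B \<and>
        (\<forall>B'. base M B' \<longrightarrow> B' - P \<subseteq> B - P \<longrightarrow> B' - P = B - P)"
      by (intro exI[of _ B]) simp
  next
    assume "\<exists>B. base M B \<and> K = ground M - P - B \<and>
        (\<forall>B'. base M B' \<longrightarrow> B' - P \<subseteq> B - P \<longrightarrow> B' - P = B - P)"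
    then obtain B where B: "base M B" "K = ground M - P - B"
      "\<And>B'. base M B' \<Longrightarrow> B' - P \<subseteq> B - P \<Longrightarrow> B' - P = B - P" by auto
    have "Y = K" if Y: "base M B'" "Y \<subseteq> ground M - B'" "Y \<inter> P = {}" "K \<subseteq> Y" for Y B'
    proof -
      have "B' - P \<subseteq> B - P" using G[OF Y(1)] B(2) Y by auto
      then have "B' - P = B - P" using B(3) Y(1) by simp
      then show ?thesis using Y B(2) by auto
    qed
    then show "base (deletion (dual M) P) K"
      unfolding S maximal_in_def using B(1,2) by auto
  qed
qed

lemma indep_contraction_iff:
  "I \<in> indep (contraction M P) \<longleftrightarrow>
    (\<exists>B. base M B \<and> (\<forall>B'. base M B' \<longrightarrow> B' - P \<subseteq> B - P \<longrightarrow> B' - P = B - P) \<and> I \<subseteq> B - P)"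
    (is "?L \<longleftrightarrow> ?R")
proof -
  have "?L \<longleftrightarrow> (\<exists>K. base (deletion (dual M) P) K \<and> I \<subseteq> ground M - P - K)"
    unfolding contraction_def by (subst dual_def) (simp add: deletion_def dual_def)
  also have "\<dots> \<longleftrightarrow> (\<exists>B. base M B \<and> (\<forall>B'. base M B' \<longrightarrow> B' - P \<subseteq> B - P \<longrightarrow> B' - P = B - P) \<and>
      I \<subseteq> ground M - P - (ground M - P - B))"
    unfolding base_deletion_dual_iff by blast
  also have "\<dots> \<longleftrightarrow> ?R"
  proof -
    have "ground M - P - (ground M - P - B) = B - P" if "base M B" for B
      using indep_ground[OF M base_indep[OF M that]] by auto
    then show ?thesis by (metis (no_types, lifting))
  qed
  finally show ?thesis .
qed

lemma ground_contraction: "ground (contraction M P) = ground M - P"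
  by (simp add: contraction_def dual_def deletion_def)

text \<open>A base whose part outside \<open>P\<close> is minimal has a maximal independent part
  inside \<open>P\<close>: enlarging the inside part and completing from \<open>B\<close> would lose
  something outside. With the converse below, this is the usual description of contraction.\<close>

lemma indep_contractionD:
  assumes "I \<in> indep (contraction M P)"
  obtains B where "base M B" "I \<subseteq> B - P" "\<And>x. x \<in> P - B \<Longrightarrow> insert x (B \<inter> P) \<notin> indep M"
proof -
  obtain B where B: "base M B" "I \<subseteq> B - P"
    and min: "\<And>B'. base M B' \<Longrightarrow> B' - P \<subseteq> B - P \<Longrightarrow> B' - P = B - P"
    using assms indep_contraction_iff by auto
  have "insert x (B \<inter> P) \<notin> indep M" if x: "x \<in> P - B" for x
  proof
    assume "insert x (B \<inter> P) \<in> indep M"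
    then obtain B2 where B2: "base M B2" "insert x (B \<inter> P) \<subseteq> B2" "B2 \<subseteq> insert x (B \<inter> P) \<union> B"
      using indep_extend_base[OF M _ B(1)] by blast
    have "B2 - P \<subseteq> B - P" using B2(3) x by blast
    from min[OF B2(1) this] have "B \<subseteq> B2" using B2(2) by blast
    then have "B2 = B" by (rule base_subset_eq[OF M B(1) B2(1)])
    with B2(2) x show False by blast
  qed
  with B that show ?thesis by blast
qed

lemma indep_contractionI:
  assumes B: "base M B" "I \<subseteq> B - P" and max: "\<And>x. x \<in> P - B \<Longrightarrow> insert x (B \<inter> P) \<notin> indep M"
  shows "I \<in> indep (contraction M P)"
  unfolding indep_contraction_iff
proof (intro exI[of _ B] conjI allI impI)
  show "base M B" "I \<subseteq> B - P" by fact+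
  fix B' assume B': "base M B'" "B' - P \<subseteq> B - P"
  show "B' - P = B - P"
  proof (rule ccontr)
    \<comment> \<open>A lost \<open>z\<close> can be replaced only by some \<open>w\<close> of
      \<open>B'\<close>, and \<open>w\<close> has to come from \<open>P\<close>, where
      \<open>B\<close> is already maximal.\<close>
    assume "B' - P \<noteq> B - P"
    then obtain z where z: "z \<in> B - P" "z \<notin> B'" using B'(2) by blast
    have i: "B - {z} \<in> indep M" by (rule indep_mono[OF M base_indep[OF M B(1)]]) blast
    have "\<not> base M (B - {z})" using base_subset_eq[OF M _ B(1), of "B - {z}"] z by blast
    then obtain w where w: "w \<in> B' - (B - {z})" "insert w (B - {z}) \<in> indep M"
      using base_augment[OF M B'(1) i] by blast
    have "w \<noteq> z" using w z by blast
    with w(1) B'(2) have wP: "w \<in> P - B" by blast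
    have "insert w (B \<inter> P) \<in> indep M" by (rule indep_mono[OF M w(2)]) (use z in blast)
    with max[OF wP] show False ..
  qed
qed

text \<open>For \<open>J\<close> maximal independent in \<open>P\<close>, any base containing
  \<open>I \<union> J\<close> would meet \<open>P\<close> exactly in \<open>J\<close> and witness
  independence of \<open>I\<close>. So \<open>I \<union> J\<close> contains a circuit, which cannot
  lie inside \<open>J\<close>.\<close>

lemma contraction_dependentD:
  assumes I: "I \<subseteq> ground M - P" "I \<notin> indep (contraction M P)" and P: "P \<subseteq> ground M"
  obtains C where "circuit M C" "C \<subseteq> I \<union> P" "C \<inter> I \<noteq> {}"
proof -
  obtain J where J: "J \<in> indep M" "{} \<subseteq> J" "J \<subseteq> P" "\<And>x. x \<in> P - J \<Longrightarrow> insert x J \<notin> indep M"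
    by (rule maximal_between[OF M indep_empty[OF M] _ P]) auto
  have "I \<union> J \<notin> indep M"
  proof
    assume "I \<union> J \<in> indep M"
    then obtain B where B: "base M B" "I \<union> J \<subseteq> B" using indep_base[OF M] by blast
    have "B \<inter> P = J"
    proof (intro equalityI subsetI)
      fix x assume x: "x \<in> B \<inter> P"
      have "insert x J \<in> indep M" by (rule indep_mono[OF M base_indep[OF M B(1)]]) (use B x in blast)
      then show "x \<in> J" using J(4) x by blast
    qed (use B J in blast)
    then have "I \<in> indep (contraction M P)"
      using J(4) B I(1) by (intro indep_contractionI[OF B(1)]) auto
    with I show False by blast
  qed
  then obtain C where C: "circuit M C" "C \<subseteq> I \<union> J"
    using dependent_contains_circuit[OF M, of "I \<union> J"] I(1) indep_ground[OF M J(1)] by blast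
  have "\<not> C \<subseteq> J" using circuitD(2)[OF M C(1)] indep_mono[OF M J(1)] by blast
  then have "C \<inter> I \<noteq> {}" using C(2) by blast
  with C J(3) that show ?thesis by blast
qed

text \<open>The fundamental cocircuit of \<open>e\<close> avoids \<open>P\<close>, since
  \<open>B \<inter> P\<close> spans \<open>P\<close>: at a common \<open>x\<close>, the fundamental
  circuit of \<open>x\<close> over \<open>B \<inter> P\<close> would meet it in \<open>x\<close>
  alone.\<close>

lemma contraction_cocircuit:
  assumes I: "I \<in> indep (contraction M P)" and e: "e \<in> I" and P: "P \<subseteq> ground M"
  obtains D where "cocircuit M D" "D \<inter> P = {}" "D \<inter> I = {e}"
proof -
  obtain B where B: "base M B" "I \<subseteq> B - P" "\<And>x. x \<in> P - B \<Longrightarrow> insert x (B \<inter> P) \<notin> indep M"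
    using indep_contractionD[OF I] by blast
  obtain D where D: "cocircuit M D" "D \<inter> B = {e}"
    using fundamental_cocircuit[OF M B(1), of e] B(2) e by blast
  have "D \<inter> P = {}"
  proof (rule ccontr)
    assume "D \<inter> P \<noteq> {}"
    then obtain x where x: "x \<in> D" "x \<in> P" by blast
    have xB: "x \<notin> B" using D(2) x B(2) e by auto
    have i: "B \<inter> P \<in> indep M" by (rule indep_mono[OF M base_indep[OF M B(1)]]) blast
    obtain C where C: "circuit M C" "x \<in> C" "C \<subseteq> insert x (B \<inter> P)"
      using fundamental_circuit[OF M i B(3)] x xB P by blast
    have "C \<inter> D \<subseteq> insert x (P \<inter> {e})" using C(3) D(2) by blast
    then have "C \<inter> D = {x}" using C(2) x(1) B(2) e by blast
    with circuit_cocircuit_Int[OF M C(1) D(1)] show False by blast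
  qed
  moreover have "D \<inter> I = {e}" using D(2) B(2) e by auto
  ultimately show ?thesis using D(1) that by blast
qed

lemma contraction_indepD:
  assumes I: "I \<in> indep (contraction M P)" and P: "P \<subseteq> ground M"
    and C: "circuit M C" "C \<subseteq> I \<union> P"
  shows "C \<inter> I = {}"
proof (rule ccontr)
  assume "C \<inter> I \<noteq> {}"
  then obtain e where e: "e \<in> C" "e \<in> I" by blast
  obtain D where D: "cocircuit M D" "D \<inter> P = {}" "D \<inter> I = {e}"
    using contraction_cocircuit[OF I e(2) P] .
  have "C \<inter> D = {e}" using C(2) D(2,3) e by auto
  with circuit_cocircuit_Int[OF M C(1) D(1)] show False by blast
qed

end

section \<open>Compactness\<close>

text \<open>Tychonoff's theorem for a power of a finite discrete space; the first assumption says
  that the complement of each \<open>Z i\<close> is a union of basic open sets.\<close>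

lemma finite_range_compactness:
  fixes Z :: "'i \<Rightarrow> ('x \<Rightarrow> 'v::finite) set"
  assumes closed: "\<And>i g. g \<notin> Z i \<Longrightarrow> \<exists>J. finite J \<and> (\<forall>h. (\<forall>x\<in>J. h x = g x) \<longrightarrow> h \<notin> Z i)"
    and fip: "\<And>W. finite W \<Longrightarrow> (\<Inter>i\<in>W. Z i) \<noteq> {}"
  shows "(\<Inter>i. Z i) \<noteq> {}"
proof -
  let ?X = "product_topology (\<lambda>_::'x. discrete_topology (UNIV :: 'v set)) UNIV"
  have "compact_space ?X"
    by (simp add: compact_space_product_topology compact_space_discrete_topology)
  moreover have "closedin ?X (Z i)" for i
  proof -
    have "\<exists>U. finite {x. U x \<noteq> (UNIV :: 'v set)} \<and> g \<in> Pi\<^sub>E UNIV U \<and> Pi\<^sub>E UNIV U \<subseteq> - Z i"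
      if g: "g \<in> - Z i" for g
    proof -
      obtain J where J: "finite J" "\<And>h. (\<forall>x\<in>J. h x = g x) \<Longrightarrow> h \<notin> Z i"
        using closed[of g i] g by auto
      let ?U = "\<lambda>x. if x \<in> J then {g x} else UNIV"
      have "finite {x. ?U x \<noteq> UNIV}" by (rule finite_subset[OF _ J(1)]) auto
      moreover have "g \<in> Pi\<^sub>E UNIV ?U" by auto
      moreover have "Pi\<^sub>E UNIV ?U \<subseteq> - Z i"
      proof
        fix h assume h: "h \<in> Pi\<^sub>E UNIV ?U"
        have "h x = g x" if "x \<in> J" for x using PiE_mem[OF h, of x] that by simp
        then show "h \<in> - Z i" using J(2) by blast
      qed
      ultimately show ?thesis by (intro exI[of _ ?U] conjI)
    qed
    then have "openin ?X (- Z i)" by (auto simp: openin_product_topology_alt)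
    then show ?thesis by (simp add: closedin_def Compl_eq_Diff_UNIV)
  qed
  moreover have "\<Inter>\<F> \<noteq> {}" if F: "finite \<F>" "\<F> \<subseteq> range Z" for \<F>
  proof -
    obtain W where "finite W" "\<F> = Z ` W" using finite_subset_image[OF F] by auto
    then show ?thesis using fip[of W] by simp
  qed
  ultimately show ?thesis
    unfolding compact_space_fip by (auto dest!: spec[of _ "range Z"])
qed

section \<open>Thin sums matroids\<close>

text \<open>Any finite superset of the support may carry the sum, so dependences with different
  supports can be compared over one index set.\<close>

lemma thin_dependence_iff:
  "thin_dependence E A f l \<longleftrightarrow>
    (\<forall>a\<in>A. \<exists>T. finite T \<and> T \<subseteq> E \<and> {e\<in>E. l e * f e a \<noteq> 0} \<subseteq> T \<and> (\<Sum>e\<in>T. l e * f e a) = 0)"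
  (is "_ \<longleftrightarrow> (\<forall>a\<in>A. ?R a)")
proof -
  have "finite {e\<in>E. l e * f e a \<noteq> 0} \<and> (\<Sum>e | e \<in> E \<and> l e * f e a \<noteq> 0. l e * f e a) = 0 \<longleftrightarrow> ?R a"
    (is "?L \<longleftrightarrow> _") for a
  proof
    assume ?L
    then show "?R a" by (intro exI[of _ "{e\<in>E. l e * f e a \<noteq> 0}"]) auto
  next
    assume "?R a"
    then obtain T where T: "finite T" "T \<subseteq> E" "{e\<in>E. l e * f e a \<noteq> 0} \<subseteq> T" "(\<Sum>e\<in>T. l e * f e a) = 0"
      by blast
    have "(\<Sum>e\<in>T. l e * f e a) = (\<Sum>e | e \<in> E \<and> l e * f e a \<noteq> 0. l e * f e a)"
      using T(1-3) by (intro sum.mono_neutral_right) auto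
    with T show ?L using finite_subset by metis
  qed
  then show ?thesis unfolding thin_dependence_def by simp
qed

lemma thin_dependenceD:
  assumes "thin_dependence E A f l" "a \<in> A" "finite T" "T \<subseteq> E" "{e\<in>E. l e * f e a \<noteq> 0} \<subseteq> T"
  shows "(\<Sum>e\<in>T. l e * f e a) = 0"
proof -
  have "(\<Sum>e\<in>T. l e * f e a) = (\<Sum>e | e \<in> E \<and> l e * f e a \<noteq> 0. l e * f e a)"
    using assms by (intro sum.mono_neutral_right) auto
  with assms show ?thesis by (simp add: thin_dependence_def)
qed

lemma thin_dependence_cong:
  assumes "\<And>e. e \<in> E \<Longrightarrow> l e = l' e"
  shows "thin_dependence E A f l \<longleftrightarrow> thin_dependence E A f l'"
proof -
  have "{e\<in>E. l e * f e a \<noteq> 0} = {e\<in>E. l' e * f e a \<noteq> 0}" for a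
    using assms by auto
  then show ?thesis unfolding thin_dependence_def using assms by simp
qed

lemma thin_dependence_add_scale:
  assumes "thin_dependence E A f l" "thin_dependence E A f m"
  shows "thin_dependence E A f (\<lambda>e. l e + c * m e)"
  unfolding thin_dependence_iff
proof
  fix a assume a: "a \<in> A"
  let ?T = "{e\<in>E. l e * f e a \<noteq> 0} \<union> {e\<in>E. m e * f e a \<noteq> 0}"
  have T: "finite ?T" using assms a by (auto simp: thin_dependence_def)
  have "(\<Sum>e\<in>?T. l e * f e a) = 0" "(\<Sum>e\<in>?T. m e * f e a) = 0"
    by (rule thin_dependenceD[OF assms(1) a T] thin_dependenceD[OF assms(2) a T]; blast)+
  then have "(\<Sum>e\<in>?T. (l e + c * m e) * f e a) = 0"
    by (simp add: distrib_right sum.distrib mult.assoc flip: sum_distrib_left)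
  moreover have "{e\<in>E. (l e + c * m e) * f e a \<noteq> 0} \<subseteq> ?T"
    by (auto simp: algebra_simps)
  ultimately show "\<exists>T. finite T \<and> T \<subseteq> E \<and> {e\<in>E. (l e + c * m e) * f e a \<noteq> 0} \<subseteq> T \<and>
      (\<Sum>e\<in>T. (l e + c * m e) * f e a) = 0"
    using T by (intro exI[of _ ?T]) auto
qed

lemma thin_dependence_diff_sum:
  assumes "finite X" "thin_dependence E A f l" "\<And>x. x \<in> X \<Longrightarrow> thin_dependence E A f (m x)"
  shows "thin_dependence E A f (\<lambda>e. l e - (\<Sum>x\<in>X. c x * m x e))"
  using assms(1,3)
proof (induction X rule: finite_induct)
  case empty
  then show ?case using assms(2) by simp
next
  case (insert x X)
  have "thin_dependence E A f (\<lambda>e. (l e - (\<Sum>x\<in>X. c x * m x e)) + (- c x) * m x e)"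
    using insert by (intro thin_dependence_add_scale) auto
  moreover have "(\<lambda>e. (l e - (\<Sum>x\<in>X. c x * m x e)) + (- c x) * m x e) =
      (\<lambda>e. l e - (\<Sum>x\<in>insert x X. c x * m x e))"
    using insert(1,2) by (auto simp: fun_eq_iff)
  ultimately show ?case by simp
qed

section \<open>Thin dependences and their orthogonality to cocircuits\<close>

context
  fixes M :: "'a indep_system" and A :: "'b set" and f :: "'a \<Rightarrow> 'b \<Rightarrow> 'k::{field,finite}"
  assumes M: "matroid M"
    and thin: "indep M = {I. I \<subseteq> ground M \<and> thin_indep (ground M) A f I}"
begin

lemma dependent_if_thin_dependence:
  assumes "thin_dependence (ground M) A f l" "e \<in> ground M" "l e \<noteq> 0" "\<And>x. x \<in> ground M - I \<Longrightarrow> l x = 0"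
  shows "I \<notin> indep M"
  using assms unfolding thin thin_indep_def by blast

text \<open>A zero inside \<open>C\<close> would leave a nonzero thin dependence on an independent
  proper subset.\<close>

lemma circuit_thin_dependence:
  assumes C: "circuit M C"
  shows "\<exists>l. thin_dependence (ground M) A f l \<and> (\<forall>e. l e \<noteq> 0 \<longleftrightarrow> e \<in> C)"
proof -
  have "\<not> thin_indep (ground M) A f C" using circuitD(1,2)[OF M C] thin by simp
  then obtain l e where l: "thin_dependence (ground M) A f l" "\<And>x. x \<in> ground M - C \<Longrightarrow> l x = 0"
    "e \<in> ground M" "l e \<noteq> 0"
    unfolding thin_indep_def by blast
  have nz: "l x \<noteq> 0" if "x \<in> C" for x
  proof
    assume "l x = 0"
    then have "C - {x} \<notin> indep M"
      using l by (intro dependent_if_thin_dependence[OF l(1,3,4)]) auto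
    with circuitD(3)[OF M C that] show False by blast
  qed
  \<comment> \<open>Values off the ground set are unconstrained; clearing them makes the support
    exactly \<open>C\<close>.\<close>
  let ?l = "\<lambda>x. if x \<in> C then l x else 0"
  have "thin_dependence (ground M) A f ?l \<longleftrightarrow> thin_dependence (ground M) A f l"
    by (rule thin_dependence_cong) (use l(2) in auto)
  with l(1) nz show ?thesis by (intro exI[of _ ?l]) auto
qed

text \<open>
  On the support \<open>S\<close> of \<open>l\<close> every equation involves only finitely many coordinates, so compactness
  allows to clear all coordinates of \<open>S - {e}\<close> outside a maximal independent subset \<open>I\<close>; then
  \<open>e\<close> lies on a circuit inside \<open>insert e I\<close>.
\<close>

lemma thin_dependence_cocircuit:
  assumes l: "thin_dependence (ground M) A f l" and D: "cocircuit M D" and e: "e \<in> D"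
    and zero: "\<And>x. x \<in> D \<Longrightarrow> x \<noteq> e \<Longrightarrow> l x = 0"
  shows "l e = 0"
proof (rule ccontr)
  assume le: "l e \<noteq> 0"
  let ?E = "ground M"
  define S where "S = {x \<in> ?E. l x \<noteq> 0}"
  have eE: "e \<in> ?E" using cocircuitD(1)[OF M D] e by blast
  have S: "S \<subseteq> ?E" "e \<in> S" "S \<inter> D \<subseteq> {e}" using eE le zero by (auto simp: S_def)
  obtain I where I: "I \<in> indep M" "{} \<subseteq> I" "I \<subseteq> S - {e}" "\<And>x. x \<in> S - {e} - I \<Longrightarrow> insert x I \<notin> indep M"
    by (rule maximal_between[OF M indep_empty[OF M], of "S - {e}"]) (use S in auto)
  have "\<exists>m. thin_dependence ?E A f m \<and> m x = 1 \<and> (\<forall>y. y \<notin> insert x I \<longrightarrow> m y = 0)"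
    if x: "x \<in> S - {e} - I" for x
  proof -
    obtain C where C: "circuit M C" "x \<in> C" "C \<subseteq> insert x I"
      using fundamental_circuit[OF M I(1) I(4)[OF x]] x S by blast
    obtain m where m: "thin_dependence ?E A f m" "\<And>y. m y \<noteq> 0 \<longleftrightarrow> y \<in> C"
      using circuit_thin_dependence[OF C(1)] by blast
    have "thin_dependence ?E A f (\<lambda>y. 0 + inverse (m x) * m y)"
      by (rule thin_dependence_add_scale[OF _ m(1)]) (simp add: thin_dependence_def)
    then show ?thesis
      using m(2)[of x] C(2,3) m(2) by (intro exI[of _ "\<lambda>y. inverse (m x) * m y"]) auto
  qed
  then obtain m where m: "\<And>x. x \<in> S - {e} - I \<Longrightarrow> thin_dependence ?E A f (m x)"
    "\<And>x. x \<in> S - {e} - I \<Longrightarrow> m x x = 1"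
    "\<And>x y. x \<in> S - {e} - I \<Longrightarrow> y \<notin> insert x I \<Longrightarrow> m x y = 0"
    by metis
  \<comment> \<open>Each \<open>Z x\<close> asks for the vanishing of only one coordinate, so
    finitely many of them need only a finite elimination. Fixing the value at \<open>e\<close> keeps
    the limit nonzero.\<close>
  define Z where "Z x = {g. thin_dependence ?E A f g \<and> (\<forall>y. y \<notin> S \<longrightarrow> g y = 0) \<and> g e = 1 \<and>
      (x \<in> S - {e} - I \<longrightarrow> g x = 0)}" for x
  have "(\<Inter>x. Z x) \<noteq> {}"
  proof (rule finite_range_compactness)
    fix x g assume g: "g \<notin> Z x"
    consider y where "y \<notin> S" "g y \<noteq> 0" | "g e \<noteq> 1" | "x \<in> S - {e} - I" "g x \<noteq> 0"
      | "\<not> thin_dependence ?E A f g" "\<And>y. y \<notin> S \<Longrightarrow> g y = 0"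
      using g unfolding Z_def by blast
    then show "\<exists>J. finite J \<and> (\<forall>h. (\<forall>x\<in>J. h x = g x) \<longrightarrow> h \<notin> Z x)"
    proof cases
      case 1
      then show ?thesis by (intro exI[of _ "{y}"]) (auto simp: Z_def)
    next
      case 2
      then show ?thesis by (intro exI[of _ "{e}"]) (auto simp: Z_def)
    next
      case 3
      then show ?thesis by (intro exI[of _ "{x}"]) (auto simp: Z_def)
    next
      case 4
      \<comment> \<open>As \<open>l\<close> has no zero on \<open>S\<close>, the finiteness built
        into its being a thin dependence bounds the support of the whole equation \<open>a\<close>
        on \<open>S\<close>.\<close>
      have fin: "finite {x \<in> S. f x a \<noteq> 0}" if "a \<in> A" for a
      proof -
        have "{x \<in> S. f x a \<noteq> 0} = {x \<in> ?E. l x * f x a \<noteq> 0}" by (auto simp: S_def)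
        with l that show ?thesis by (simp add: thin_dependence_def)
      qed
      from 4(1) obtain a where a: "a \<in> A"
        "\<And>T. finite T \<Longrightarrow> T \<subseteq> ?E \<Longrightarrow> {y\<in>?E. g y * f y a \<noteq> 0} \<subseteq> T \<Longrightarrow> (\<Sum>y\<in>T. g y * f y a) \<noteq> 0"
        unfolding thin_dependence_iff by blast
      let ?J = "{x \<in> S. f x a \<noteq> 0}"
      have "(\<Sum>y\<in>?J. g y * f y a) \<noteq> 0"
        by (rule a(2)[OF fin[OF a(1)]]) (use S 4(2) in auto)
      have "h \<notin> Z x" if h: "\<forall>x\<in>?J. h x = g x" for h
      proof
        assume "h \<in> Z x"
        then have hh: "thin_dependence ?E A f h" "\<And>y. y \<notin> S \<Longrightarrow> h y = 0" by (auto simp: Z_def)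
        have "(\<Sum>y\<in>?J. h y * f y a) = 0"
          by (rule thin_dependenceD[OF hh(1) a(1) fin[OF a(1)]]) (use S hh(2) in auto)
        then have "(\<Sum>y\<in>?J. g y * f y a) = 0" using h by simp
        then show False using \<open>(\<Sum>y\<in>?J. g y * f y a) \<noteq> 0\<close> by blast
      qed
      then show ?thesis using fin[OF a(1)] by blast
    qed
  next
    fix W :: "'a set" assume W: "finite W"
    define X where "X = W \<inter> (S - {e} - I)"
    \<comment> \<open>Since \<open>m x\<close> lives on \<open>insert x I\<close>, subtracting
      \<open>l x * m x\<close> clears \<open>x\<close> and changes neither the value at
      \<open>e\<close> nor any other coordinate to be cleared.\<close>
    let ?g = "\<lambda>y. (if y \<in> S then l y else 0) - (\<Sum>x\<in>X. l x * m x y)"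
    have X: "finite X" "\<And>x. x \<in> X \<Longrightarrow> x \<in> S - {e} - I" using W by (auto simp: X_def)
    have l': "thin_dependence ?E A f (\<lambda>y. if y \<in> S then l y else 0)"
      by (rule iffD1[OF thin_dependence_cong l]) (auto simp: S_def)
    have 1: "thin_dependence ?E A f ?g"
      by (rule thin_dependence_diff_sum[OF X(1) l']) (use m(1) X(2) in blast)
    have 2: "?g y = 0" if "y \<notin> S" for y
    proof -
      have "m x y = 0" if x: "x \<in> X" for x
        by (rule m(3)[OF X(2)[OF x]]) (use X(2)[OF x] I(3) \<open>y \<notin> S\<close> in blast)
      then show ?thesis using that by simp
    qed
    have 3: "?g e = l e"
    proof -
      have "m x e = 0" if x: "x \<in> X" for x
        by (rule m(3)[OF X(2)[OF x]]) (use X(2)[OF x] I(3) in blast)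
      then show ?thesis using S(2) by simp
    qed
    have 4: "?g y = 0" if y: "y \<in> W" "y \<in> S - {e} - I" for y
    proof -
      have yX: "y \<in> X" using y by (simp add: X_def)
      have z: "m x y = 0" if x: "x \<in> X" "x \<noteq> y" for x
        by (rule m(3)[OF X(2)[OF x(1)]]) (use x(2) y(2) in blast)
      have "(\<Sum>x\<in>X. l x * m x y) = l y * m y y"
        by (rule sum.remove[OF X(1) yX, THEN trans]) (simp add: z)
      then show ?thesis using y m(2)[OF y(2)] by simp
    qed
    let ?h = "\<lambda>y. inverse (l e) * ?g y"
    have "thin_dependence ?E A f (\<lambda>y. 0 + inverse (l e) * ?g y)"
      by (rule thin_dependence_add_scale[OF _ 1]) (simp add: thin_dependence_def)
    then have "thin_dependence ?E A f ?h" by simp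
    moreover have "?h e = 1" using 3 le by simp
    ultimately have "?h \<in> Z w" if "w \<in> W" for w
      using 2 4[OF that] by (auto simp: Z_def simp del: right_diff_distrib)
    then show "(\<Inter>x\<in>W. Z x) \<noteq> {}" by blast
  qed
  then obtain g where g: "\<And>x. g \<in> Z x" by blast
  have gx: "g x = 0" if "x \<notin> insert e I" for x
    using g[of x] that by (cases "x \<in> S") (auto simp: Z_def)
  have "insert e I \<notin> indep M"
    using g[of e] gx by (intro dependent_if_thin_dependence[of g e]) (auto simp: Z_def eE)
  then obtain C where C: "circuit M C" "e \<in> C" "C \<subseteq> insert e I"
    using fundamental_circuit[OF M I(1) _ eE] by blast
  \<comment> \<open>\<open>I\<close> lies in \<open>S - {e}\<close>, which misses
    \<open>D\<close>.\<close>
  have "C \<inter> D = {e}" using C(2,3) e I(3) S(3) by blast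
  then show False using circuit_cocircuit_Int[OF M C(1) D] by blast
qed

end

text \<open>Values off circuits and off cocircuits are left arbitrary. Sums over infinite sets are 0
  by convention, so the last clause has content only for finite \<open>C \<inter> D\<close>, the
  only case in a tame matroid.\<close>

definition painting :: "'a indep_system \<Rightarrow> ('a set \<Rightarrow> 'a \<Rightarrow> 'k::field) \<Rightarrow> ('a set \<Rightarrow> 'a \<Rightarrow> 'k) \<Rightarrow> bool" where
  "painting M c d \<longleftrightarrow>
    (\<forall>C. circuit M C \<longrightarrow> (\<forall>e\<in>C. c C e \<noteq> 0)) \<and>
    (\<forall>D. cocircuit M D \<longrightarrow> (\<forall>e\<in>D. d D e \<noteq> 0)) \<and>
    (\<forall>C D. circuit M C \<longrightarrow> cocircuit M D \<longrightarrow> (\<Sum>e\<in>C \<inter> D. c C e * d D e) = 0)"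

lemma painting_if_thin_sums_matroid:
  fixes M :: "'a indep_system"
  assumes thin: "thin_sums_matroid TYPE('k::{field,finite}) M" and tame: "tame M"
  obtains c d :: "'a set \<Rightarrow> 'a \<Rightarrow> 'k::{field,finite}" where "painting M c d"
proof -
  obtain A and f :: "'a \<Rightarrow> ('a \<Rightarrow> 'k) \<Rightarrow> 'k" where M: "matroid M"
    and f: "indep M = {I. I \<subseteq> ground M \<and> thin_indep (ground M) A f I}"
    using thin unfolding thin_sums_matroid_def by blast
  obtain c where c: "\<And>C. circuit M C \<Longrightarrow> thin_dependence (ground M) A f (c C)"
    "\<And>C e. circuit M C \<Longrightarrow> c C e \<noteq> 0 \<longleftrightarrow> e \<in> C"
    using circuit_thin_dependence[OF M f] by metis
  have "\<exists>d :: 'a \<Rightarrow> 'k. (\<forall>e\<in>D. d e \<noteq> 0) \<and> (\<forall>C. circuit M C \<longrightarrow> (\<Sum>e\<in>C \<inter> D. c C e * d e) = 0)"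
    if D: "cocircuit M D" for D
  proof -
    obtain e where e: "e \<in> D" using cocircuit_nonempty[OF M D] by blast
    have "\<exists>C. circuit M C \<and> C \<inter> D = {e, x}" if "x \<in> D - {e}" for x
      using circuit_through_two[OF M D e, of x] that by blast
    then obtain K where K: "\<And>x. x \<in> D - {e} \<Longrightarrow> circuit M (K x)" "\<And>x. x \<in> D - {e} \<Longrightarrow> K x \<inter> D = {e, x}"
      by metis
    have Kz: "c (K x) y \<noteq> 0 \<longleftrightarrow> y = e \<or> y = x" if "x \<in> D - {e}" "y \<in> D" for x y
      using c(2)[OF K(1)[OF that(1)], of y] K(2)[OF that(1)] that(2) by blast
    \<comment> \<open>Normalised at \<open>e\<close>; the value at \<open>x\<close> is the one that
      orthogonality to \<open>K x\<close> forces.\<close>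
    define d where "d x = (if x = e then 1 else - (c (K x) e / c (K x) x))" for x
    have "d x \<noteq> 0" if "x \<in> D" for x
      using Kz[of x x] Kz[of x e] that e by (auto simp: d_def)
    moreover have "(\<Sum>x\<in>C \<inter> D. c C x * d x) = 0" if C: "circuit M C" for C
    proof -
      have fin: "finite (C \<inter> D)" using tame C D by (auto simp: tame_def)
      let ?X = "C \<inter> D - {e}"
      \<comment> \<open>Clears \<open>c C\<close> on \<open>D - {e}\<close>: each \<open>K x\<close>
        meets \<open>D\<close> only in \<open>e\<close> and \<open>x\<close>, so the subtractions do
        not interfere there.\<close>
      let ?l = "\<lambda>y. c C y - (\<Sum>x\<in>?X. (c C x / c (K x) x) * c (K x) y)"
      have "thin_dependence (ground M) A f ?l"
        by (rule thin_dependence_diff_sum) (use fin c(1) C K(1) in auto)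
      moreover have "?l y = 0" if y: "y \<in> D" "y \<noteq> e" for y
      proof (cases "y \<in> C")
        case True
        have "(\<Sum>x\<in>?X. (c C x / c (K x) x) * c (K x) y) = (c C y / c (K y) y) * c (K y) y"
        proof (rule sum.remove[where x = y, THEN trans])
          show "y \<in> ?X" using True y by blast
          have "(\<Sum>x\<in>?X - {y}. (c C x / c (K x) x) * c (K x) y) = 0"
            by (rule sum.neutral) (use Kz[OF _ y(1)] y in auto)
          then show "c C y / c (K y) y * c (K y) y + (\<Sum>x\<in>?X - {y}. (c C x / c (K x) x) * c (K x) y)
              = c C y / c (K y) y * c (K y) y" by simp
        qed (use fin in simp)
        then show ?thesis using Kz[of y y] y by simp
      next
        case False
        have "(\<Sum>x\<in>?X. (c C x / c (K x) x) * c (K x) y) = 0"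
          by (rule sum.neutral) (use Kz[OF _ y(1)] y False in auto)
        then show ?thesis using c(2)[OF C, of y] False by simp
      qed
      \<comment> \<open>By the choice of \<open>d\<close>, the value left at \<open>e\<close> is
        exactly the sum to be shown zero.\<close>
      ultimately have "?l e = 0"
        by (rule thin_dependence_cocircuit[OF M f _ D e])
      moreover have "(\<Sum>x\<in>?X. (c C x / c (K x) x) * c (K x) e) = - (\<Sum>x\<in>?X. c C x * d x)"
        unfolding sum_negf[symmetric] by (rule sum.cong) (auto simp: d_def)
      ultimately have *: "c C e + (\<Sum>x\<in>?X. c C x * d x) = 0" by simp
      show ?thesis
      proof (cases "e \<in> C")
        case True
        then have "(\<Sum>x\<in>C \<inter> D. c C x * d x) = c C e * d e + (\<Sum>x\<in>?X. c C x * d x)"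
          using fin e by (intro sum.remove) auto
        with * show ?thesis by (simp add: d_def)
      next
        case False
        then have "?X = C \<inter> D" "c C e = 0" using c(2)[OF C, of e] by auto
        with * show ?thesis by simp
      qed
    qed
    ultimately show ?thesis by blast
  qed
  then obtain d where d: "\<And>D e. cocircuit M D \<Longrightarrow> e \<in> D \<Longrightarrow> d D e \<noteq> (0::'k)"
    "\<And>C D. cocircuit M D \<Longrightarrow> circuit M C \<Longrightarrow> (\<Sum>e\<in>C \<inter> D. c C e * d D e) = 0"
    by metis
  have "painting M c d" using c d by (auto simp: painting_def)
  with that show ?thesis .
qed

lemma thin_sums_matroid_if_painting:
  fixes M :: "'a indep_system" and c d :: "'a set \<Rightarrow> 'a \<Rightarrow> 'k::field"
  assumes M: "matroid M" and tame: "tame M" and p: "painting M c d"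
  shows "thin_sums_matroid TYPE('k) M"
proof (rule thin_sums_matroidI[OF M])
  \<comment> \<open>One equation per cocircuit, with its weights as coefficients.\<close>
  let ?A = "{D. cocircuit M D}" and ?f = "\<lambda>e D. if e \<in> D then d D e else 0"
  show "indep M = {I. I \<subseteq> ground M \<and> thin_indep (ground M) ?A ?f I}"
  proof (intro equalityI subsetI)
    fix I assume I: "I \<in> indep M"
    have "thin_indep (ground M) ?A ?f I"
      unfolding thin_indep_def
    proof (intro allI impI ballI, elim conjE, rule ccontr)
      fix l e assume l: "thin_dependence (ground M) ?A ?f l" "\<forall>e\<in>ground M - I. l e = 0"
        and e: "e \<in> ground M" "l e \<noteq> 0"
      obtain B where B: "base M B" "I \<subseteq> B" using indep_base[OF M I] .
      have "e \<in> I" using l e by blast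
      then obtain D where D: "cocircuit M D" "D \<inter> B = {e}" using fundamental_cocircuit[OF M B(1)] B(2) by blast
      \<comment> \<open>\<open>l\<close> vanishes outside \<open>B\<close>, so the equation of the
        fundamental cocircuit \<open>D\<close> has a single term.\<close>
      have "(\<Sum>x\<in>{e}. l x * ?f x D) = 0"
        by (rule thin_dependenceD[OF l(1)]) (use D e(1) l(2) B(2) in \<open>auto split: if_splits\<close>)
      moreover have "e \<in> D" using D by blast
      ultimately show False using e(2) p D(1) by (auto simp: painting_def)
    qed
    with indep_ground[OF M I] show "I \<in> {I. I \<subseteq> ground M \<and> thin_indep (ground M) ?A ?f I}" by blast
  next
    fix I assume I: "I \<in> {I. I \<subseteq> ground M \<and> thin_indep (ground M) ?A ?f I}"
    show "I \<in> indep M"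
    proof (rule ccontr)
      assume "I \<notin> indep M"
      then obtain C where C: "circuit M C" "C \<subseteq> I" using dependent_contains_circuit[OF M] I by blast
      let ?l = "\<lambda>e. if e \<in> C then c C e else 0"
      have "thin_dependence (ground M) ?A ?f ?l"
        unfolding thin_dependence_iff
      proof
        fix D assume "D \<in> ?A"
        then have D: "cocircuit M D" by simp
        have "(\<Sum>x\<in>C \<inter> D. ?l x * ?f x D) = (\<Sum>x\<in>C \<inter> D. c C x * d D x)" by (rule sum.cong) auto
        also have "\<dots> = 0" using p C D by (simp add: painting_def)
        finally have "(\<Sum>x\<in>C \<inter> D. ?l x * ?f x D) = 0" .
        moreover have "finite (C \<inter> D)" using tame C D by (auto simp: tame_def)
        moreover have "C \<inter> D \<subseteq> ground M" using circuitD(1)[OF M C(1)] by blast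
        ultimately show "\<exists>T. finite T \<and> T \<subseteq> ground M \<and> {e\<in>ground M. ?l e * ?f e D \<noteq> 0} \<subseteq> T \<and>
            (\<Sum>e\<in>T. ?l e * ?f e D) = 0"
          by (intro exI[of _ "C \<inter> D"]) auto
      qed
      moreover have "\<forall>e\<in>ground M - I. ?l e = 0" using C by auto
      ultimately have z: "\<forall>e\<in>ground M. ?l e = 0" using I unfolding thin_indep_def by blast
      obtain e where "e \<in> C" using circuit_nonempty[OF M C(1)] by blast
      moreover from this have "c C e \<noteq> 0" using p C(1) by (auto simp: painting_def)
      moreover have "e \<in> ground M" using \<open>e \<in> C\<close> circuitD(1)[OF M C(1)] by blast
      ultimately show False using bspec[OF z, of e] by simp
    qed
  qed
qed

section \<open>Finite minors\<close>

lemma fun_scale_sum_apply: "(\<Sum>e\<in>I. fun_scale (c e) (w e)) i = (\<Sum>e\<in>I. c e * w e i)"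
  by (induction I rule: infinite_finite_induct) (auto simp: fun_scale_def)

lemma representable_minor_if_painting:
  fixes M :: "'a indep_system" and c d :: "'a set \<Rightarrow> 'a \<Rightarrow> 'k::field"
  assumes M: "matroid M" and p: "painting M c d" and N: "minor_of N M" and fin: "finite (ground N)"
  shows "representable TYPE('k) N"
proof -
  obtain P Q where PQ: "P \<subseteq> ground M" "Q \<subseteq> ground M" "P \<inter> Q = {}" "N = deletion (contraction M P) Q"
    using N unfolding minor_of_def by blast
  have gN: "ground N = ground M - P - Q" by (simp add: PQ deletion_def ground_contraction[OF M])
  have iN: "indep N = {I \<in> indep (contraction M P). I \<inter> Q = {}}" by (simp add: PQ deletion_def)
  \<comment> \<open>Circuits of \<open>M\<close> inside \<open>I \<union> P\<close> have weights on
    \<open>P\<close> as well; cocircuits avoiding \<open>P\<close> do not see them, so the traces on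
    \<open>I\<close> are honest linear relations.\<close>
  define v where "v e D = (if e \<in> D \<and> cocircuit M D \<and> D \<inter> P = {} then d D e else 0)" for e D
  have "I \<in> indep N \<longleftrightarrow> I \<subseteq> ground N \<and> linindep_family fun_scale v I" for I
  proof (cases "I \<subseteq> ground N")
    case False
    then have "I \<notin> indep N"
      using indep_contraction_iff[OF M, of I P] indep_ground[OF M base_indep[OF M]]
      unfolding iN gN by blast
    with False show ?thesis by blast
  next
    case I: True
    have finI: "finite I" using I fin finite_subset by blast
    have "I \<in> indep N \<longleftrightarrow> I \<in> indep (contraction M P)" using I unfolding iN gN by blast
    also have "\<dots> \<longleftrightarrow> linindep_family fun_scale v I"
      unfolding linindep_family_iff[OF vector_space_fun_scale finI]
    proof (intro iffI allI impI ballI)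
      fix u e assume Ic: "I \<in> indep (contraction M P)" and u: "(\<Sum>e\<in>I. fun_scale (u e) (v e)) = 0" and e: "e \<in> I"
      obtain D where D: "cocircuit M D" "D \<inter> P = {}" "D \<inter> I = {e}"
        using contraction_cocircuit[OF M Ic e PQ(1)] .
      have "0 = (\<Sum>x\<in>I. u x * v x D)" using u by (simp flip: fun_scale_sum_apply)
      also have "\<dots> = u e * v e D + (\<Sum>x\<in>I - {e}. u x * v x D)" by (rule sum.remove[OF finI e])
      also have "(\<Sum>x\<in>I - {e}. u x * v x D) = 0"
        by (rule sum.neutral) (use D(3) in \<open>auto simp: v_def\<close>)
      finally have "u e * v e D = 0" by simp
      moreover have "v e D \<noteq> 0" using D p by (auto simp: v_def painting_def)
      ultimately show "u e = 0" by simp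
    next
      assume R: "\<forall>u. (\<Sum>e\<in>I. fun_scale (u e) (v e)) = 0 \<longrightarrow> (\<forall>e\<in>I. u e = 0)"
      show "I \<in> indep (contraction M P)"
      proof (rule ccontr)
        assume "I \<notin> indep (contraction M P)"
        then obtain C where C: "circuit M C" "C \<subseteq> I \<union> P" "C \<inter> I \<noteq> {}"
          using contraction_dependentD[OF M _ _ PQ(1), of I] I gN by blast
        let ?u = "\<lambda>e. if e \<in> C then c C e else 0"
        have "(\<Sum>e\<in>I. ?u e * v e D) = 0" for D
        proof (cases "cocircuit M D \<and> D \<inter> P = {}")
          case True
          have "(\<Sum>e\<in>I. ?u e * v e D) = (\<Sum>e\<in>C \<inter> D. ?u e * v e D)"
            by (rule sum.mono_neutral_right[OF finI]) (use True C(2) in \<open>auto simp: v_def split: if_splits\<close>)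
          also have "\<dots> = (\<Sum>e\<in>C \<inter> D. c C e * d D e)" by (rule sum.cong) (use True in \<open>auto simp: v_def\<close>)
          also have "\<dots> = 0" using p C True by (simp add: painting_def)
          finally show ?thesis .
        next
          case False
          then have "v e D = 0" for e unfolding v_def by presburger
          then show ?thesis by simp
        qed
        then have "(\<Sum>e\<in>I. fun_scale (?u e) (v e)) = 0" by (simp add: fun_eq_iff fun_scale_sum_apply)
        then have "\<forall>e\<in>I. ?u e = 0" by (rule R[rule_format, THEN ballI])
        with C p show False by (auto simp: painting_def split: if_splits)
      qed
    qed
    finally show ?thesis using I by blast
  qed
  then have "represents fun_scale v N" by (auto simp: represents_def)
  then show ?thesis by (rule representableI[OF vector_space_fun_scale fin])
qed

section \<open>Linear relations from circuits and functionals from cocircuits, in a representation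
  of a finite minor\<close>

context
  fixes M :: "'a indep_system" and P :: "'a set"
  assumes M: "matroid M" and P: "P \<subseteq> ground M"
begin

lemma contraction_fundamental_circuit:
  assumes I: "I \<in> indep (contraction M P)" "insert x I \<notin> indep (contraction M P)" "x \<in> ground M - P"
  obtains C where "circuit M C" "x \<in> C" "C \<subseteq> insert x I \<union> P"
proof -
  have "I \<subseteq> ground M - P"
    using I(1) indep_contraction_iff[OF M, of I P] indep_ground[OF M base_indep[OF M]] by blast
  then have "insert x I \<subseteq> ground M - P" using I(3) by blast
  then obtain C where C: "circuit M C" "C \<subseteq> insert x I \<union> P" "C \<inter> insert x I \<noteq> {}"
    using contraction_dependentD[OF M _ I(2) P] by blast
  have "x \<in> C"
  proof (rule ccontr)
    assume x: "x \<notin> C"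
    then have "C \<subseteq> I \<union> P" using C(2) by blast
    from contraction_indepD[OF M I(1) P C(1) this] C(3) x show False by blast
  qed
  with C that show ?thesis by blast
qed

lemma contraction_maximal_within:
  assumes T: "finite T" "T \<subseteq> ground M - P"
  obtains I where "I \<in> indep (contraction M P)" "I \<subseteq> T"
    "\<And>x. x \<in> T - I \<Longrightarrow> insert x I \<notin> indep (contraction M P)"
proof -
  let ?S = "{I. I \<subseteq> T \<and> I \<in> indep (contraction M P)}"
  have "{} \<in> indep (contraction M P)"
    using contraction_dependentD[OF M _ _ P, of "{}"] by blast
  then have "?S \<noteq> {}" "finite ?S" using T(1) by auto
  from finite_has_maximal[OF this(2,1)] obtain I
    where I: "I \<in> ?S" "\<And>J. J \<in> ?S \<Longrightarrow> I \<subseteq> J \<Longrightarrow> I = J"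
    by (elim bexE) simp
  have "insert x I \<notin> indep (contraction M P)" if "x \<in> T - I" for x
    using I(1) I(2)[of "insert x I"] that by auto
  with I(1) that show ?thesis by blast
qed

context
  fixes F :: "'a set" and v :: "'a \<Rightarrow> 'i \<Rightarrow> 'k::field"
  assumes F: "finite F" "F \<subseteq> ground M - P"
    and rep: "\<And>I. I \<subseteq> F \<Longrightarrow> I \<in> indep (contraction M P) \<longleftrightarrow> linindep_family fun_scale v I"
begin

text \<open>In the contraction, \<open>e\<close> depends on the rest of \<open>C \<inter> F\<close>.
  Otherwise a cocircuit avoiding \<open>P\<close> separates \<open>e\<close> from \<open>I\<close>;
  it meets \<open>C\<close> in a further \<open>y\<close>, and a circuit through \<open>y\<close>
  inside \<open>insert y I \<union> P\<close> meets it in \<open>y\<close> alone.\<close>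

lemma circuit_relation:
  assumes C: "circuit M C" "C \<subseteq> F \<union> P" and e: "e \<in> C" "e \<in> F"
  shows "\<exists>l. l e = 1 \<and> (\<forall>x. l x \<noteq> 0 \<longrightarrow> x \<in> C \<inter> F) \<and> (\<Sum>x\<in>F. fun_scale (l x) (v x)) = 0"
proof -
  obtain I where I: "I \<in> indep (contraction M P)" "I \<subseteq> C \<inter> F - {e}"
    "\<And>x. x \<in> C \<inter> F - {e} - I \<Longrightarrow> insert x I \<notin> indep (contraction M P)"
    by (rule contraction_maximal_within[of "C \<inter> F - {e}"]) (use F in auto)
  have "insert e I \<notin> indep (contraction M P)"
  proof
    assume "insert e I \<in> indep (contraction M P)"
    then obtain D where D: "cocircuit M D" "D \<inter> P = {}" "D \<inter> insert e I = {e}"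
      by (rule contraction_cocircuit[OF M _ insertI1 P])
    have "C \<inter> D \<noteq> {e}" by (rule circuit_cocircuit_Int[OF M C(1) D(1)])
    moreover have "e \<in> C \<inter> D" using D(3) e by blast
    ultimately obtain y where y: "y \<in> C" "y \<in> D" "y \<noteq> e" by blast
    have yF: "y \<in> C \<inter> F - {e} - I" using y C(2) D(2,3) by blast
    obtain C2 where C2: "circuit M C2" "y \<in> C2" "C2 \<subseteq> insert y I \<union> P"
      using contraction_fundamental_circuit[OF I(1) I(3)[OF yF]] yF F by blast
    have "C2 \<inter> D = {y}"
    proof (intro equalityI subsetI)
      fix z assume z: "z \<in> C2 \<inter> D"
      have "z \<notin> I" using z D(3) I(2) by blast
      then show "z \<in> {y}" using z C2(3) D(2) by blast
    qed (use y C2 in auto)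
    with circuit_cocircuit_Int[OF M C2(1) D(1)] show False by blast
  qed
  moreover have IF: "insert e I \<subseteq> F" using I(2) e by blast
  ultimately have dep: "\<not> linindep_family fun_scale v (insert e I)" using rep by blast
  have fin: "finite I" "finite (insert e I)" using IF F(1) finite_subset by auto
  have ind: "linindep_family fun_scale v I" using rep[of I] I(1) IF by blast
  have eI: "e \<notin> I" using I(2) by blast
  from dep obtain u where u: "(\<Sum>x\<in>insert e I. fun_scale (u x) (v x)) = 0" "\<exists>x\<in>insert e I. u x \<noteq> 0"
    unfolding linindep_family_iff[OF vector_space_fun_scale fin(2)] by blast
  have ue: "u e \<noteq> 0"
  proof
    assume u0: "u e = 0"
    have "fun_scale (u e) (v e) = 0" using u0 by (simp add: fun_scale_def fun_eq_iff)
    then have "(\<Sum>x\<in>I. fun_scale (u x) (v x)) = 0" using u(1) fin eI by simp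
    then have "\<forall>x\<in>I. u x = 0" using ind unfolding linindep_family_iff[OF vector_space_fun_scale fin(1)] by blast
    with u(2) u0 show False by auto
  qed
  let ?l = "\<lambda>x. if x \<in> insert e I then inverse (u e) * u x else 0"
  have "(\<Sum>x\<in>F. ?l x * v x i) = 0" for i
  proof -
    have "(\<Sum>x\<in>F. ?l x * v x i) = (\<Sum>x\<in>insert e I. ?l x * v x i)"
      by (rule sum.mono_neutral_right[OF F(1) IF]) simp
    also have "\<dots> = inverse (u e) * (\<Sum>x\<in>insert e I. u x * v x i)"
      unfolding sum_distrib_left by (rule sum.cong) simp_all
    also have "(\<Sum>x\<in>insert e I. u x * v x i) = 0"
      using fun_cong[OF u(1), of i] unfolding fun_scale_sum_apply by simp
    finally show ?thesis by simp
  qed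
  then have "(\<Sum>x\<in>F. fun_scale (?l x) (v x)) = 0" by (simp add: fun_eq_iff fun_scale_sum_apply)
  moreover have "?l e = 1" using ue by simp
  moreover have "\<forall>x. ?l x \<noteq> 0 \<longrightarrow> x \<in> C \<inter> F" using I(2) e by auto
  ultimately show ?thesis by (intro exI[of _ ?l] conjI)
qed

text \<open>No circuit meets \<open>D\<close> in \<open>e\<close> alone, so \<open>v e\<close> lies
  outside the span of the vectors of \<open>F - D\<close>, and a linear functional separates
  them.\<close>

lemma cocircuit_functional:
  assumes D: "cocircuit M D" "D \<inter> P = {}" and e: "e \<in> D" "e \<in> F"
  shows "\<exists>p. p e = 1 \<and> (\<forall>x. p x \<noteq> 0 \<longrightarrow> x \<in> D \<inter> F) \<and>
    (\<forall>l. (\<Sum>x\<in>F. fun_scale (l x) (v x)) = 0 \<longrightarrow> (\<Sum>x\<in>F. l x * p x) = 0)"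
proof -
  interpret vector_space "fun_scale :: 'k \<Rightarrow> ('i \<Rightarrow> 'k) \<Rightarrow> _" by (rule vector_space_fun_scale)
  obtain I where I: "I \<in> indep (contraction M P)" "I \<subseteq> F - D"
    "\<And>x. x \<in> F - D - I \<Longrightarrow> insert x I \<notin> indep (contraction M P)"
    by (rule contraction_maximal_within[of "F - D"]) (use F in auto)
  have "insert e I \<in> indep (contraction M P)"
  proof (rule ccontr)
    assume "insert e I \<notin> indep (contraction M P)"
    then obtain C where C: "circuit M C" "e \<in> C" "C \<subseteq> insert e I \<union> P"
      using contraction_fundamental_circuit[OF I(1)] e F by blast
    have "C \<inter> D = {e}" using C(2,3) D(2) I(2) e by blast
    with circuit_cocircuit_Int[OF M C(1) D(1)] show False by blast
  qed
  then have "linindep_family fun_scale v (insert e I)" using rep[of "insert e I"] I(2) e by blast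
  then have inj: "inj_on v (insert e I)" and ind: "independent (insert (v e) (v ` I))"
    by (auto simp: linindep_family_def)
  have indI: "independent (v ` I)" using independent_mono[OF ind] by blast
  have sp: "v h \<in> span (v ` I)" if h: "h \<in> F - D" for h
  proof (cases "h \<in> I \<or> v h \<in> v ` I")
    case True
    then show ?thesis by (auto intro: span_base)
  next
    case False
    then have "\<not> linindep_family fun_scale v (insert h I)"
      using rep[of "insert h I"] I(2,3) h by blast
    moreover have "inj_on v (insert h I)" using False inj by (auto intro: inj_on_subset)
    ultimately have "dependent (insert (v h) (v ` I))" by (simp add: linindep_family_def)
    then show ?thesis using independent_insertI[OF _ indI] by blast
  qed
  let ?B = "extend_basis (insert (v e) (v ` I))"
  have B: "independent ?B" "span ?B = UNIV" "insert (v e) (v ` I) \<subseteq> ?B"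
    using independent_extend_basis[OF ind] span_extend_basis[OF ind] extend_basis_superset[OF ind] by auto
  \<comment> \<open>The coordinate at \<open>v e\<close> in a basis extending \<open>v e\<close> and
    a basis of the span of \<open>F - D\<close>.\<close>
  define p where "p x = (if x \<in> F then representation ?B (v x) (v e) else 0)" for x
  have "p e = 1" using e B(3) representation_basis[OF B(1), of "v e"] by (simp add: p_def)
  moreover have "p x = 0" if "x \<notin> D \<inter> F" for x
  proof (cases "x \<in> F")
    case True
    have "representation ?B (v x) = representation (v ` I) (v x)"
      by (rule representation_extend[OF B(1)]) (use B(3) sp[of x] True that in auto)
    moreover have "v e \<notin> v ` I" using inj I(2) e by (auto simp: inj_on_def)
    ultimately show ?thesis using representation_ne_zero[of "v ` I" "v x" "v e"] by (auto simp: p_def)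
  qed (simp add: p_def)
  moreover have "(\<Sum>x\<in>F. l x * p x) = 0" if l: "(\<Sum>x\<in>F. fun_scale (l x) (v x)) = 0" for l
  proof -
    have "(\<Sum>x\<in>F. l x * p x) = (\<Sum>x\<in>F. representation ?B (fun_scale (l x) (v x)) (v e))"
      by (rule sum.cong) (simp_all add: p_def representation_scale[OF B(1)] B(2))
    also have "\<dots> = representation ?B (\<Sum>x\<in>F. fun_scale (l x) (v x)) (v e)"
      by (simp add: representation_sum[OF B(1)] B(2))
    also have "\<dots> = 0" by (simp add: l representation_zero)
    finally show ?thesis .
  qed
  ultimately show ?thesis by blast
qed

end

end

text \<open>
  Contracting \<open>\<Union>CC - F\<close> may turn the trace on \<open>F\<close> of a circuit into a union of several circuits,
  over a finite field not necessarily the support of a single relation. Enlarging \<open>CC\<close> and \<open>DD\<close> by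
  the witnesses \<open>Cx\<close> and \<open>Dx\<close>, which meet a given set in just two elements, rules this out on \<open>F\<close>.
\<close>

lemma finite_painting:
  fixes M :: "'a indep_system"
  assumes M: "matroid M" and tame: "tame M"
    and rep: "\<forall>N. minor_of N M \<and> finite (ground N) \<longrightarrow> representable TYPE('k::field) N"
    and CC: "finite CC" "\<And>C. C \<in> CC \<Longrightarrow> circuit M C"
    and DD: "finite DD" "\<And>D. D \<in> DD \<Longrightarrow> cocircuit M D"
  obtains c d :: "'a set \<Rightarrow> 'a \<Rightarrow> 'k::field" where "\<And>C e. c C e \<noteq> 0" "\<And>D e. d D e \<noteq> 0"
    "\<And>C D. C \<in> CC \<Longrightarrow> D \<in> DD \<Longrightarrow> (\<Sum>e\<in>C \<inter> D. c C e * d D e) = 0"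
proof -
  \<comment> \<open>The places that enter some orthogonality condition between \<open>CC\<close> and
    \<open>DD\<close>; only here do the weights matter.\<close>
  define F where "F = (\<Union>C\<in>CC. \<Union>D\<in>DD. C \<inter> D)"
  have F: "finite F" unfolding F_def
    by (intro finite_UN_I CC(1) DD(1)) (use tame CC(2) DD(2) in \<open>auto simp: tame_def\<close>)
  have "\<exists>D. cocircuit M D \<and> C \<inter> D = {e, f}" if "circuit M C" "e \<in> C" "f \<in> C" "e \<noteq> f" for C e f
    using cocircuit_through_two[OF M that] by blast
  then obtain Dx where Dx: "\<And>C e f. circuit M C \<Longrightarrow> e \<in> C \<Longrightarrow> f \<in> C \<Longrightarrow> e \<noteq> f \<Longrightarrow>
      cocircuit M (Dx C e f) \<and> C \<inter> Dx C e f = {e, f}"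
    by metis
  have "\<exists>C. circuit M C \<and> C \<inter> D = {e, f}" if "cocircuit M D" "e \<in> D" "f \<in> D" "e \<noteq> f" for D e f
    using circuit_through_two[OF M that] by blast
  then obtain Cx where Cx: "\<And>D e f. cocircuit M D \<Longrightarrow> e \<in> D \<Longrightarrow> f \<in> D \<Longrightarrow> e \<noteq> f \<Longrightarrow>
      circuit M (Cx D e f) \<and> Cx D e f \<inter> D = {e, f}"
    by metis
  define CC' where "CC' = CC \<union> (\<lambda>(D, e, f). Cx D e f) ` {(D, e, f) \<in> DD \<times> F \<times> F. e \<in> D \<and> f \<in> D \<and> e \<noteq> f}"
  define DD' where "DD' = DD \<union> (\<lambda>(C, e, f). Dx C e f) ` {(C, e, f) \<in> CC \<times> F \<times> F. e \<in> C \<and> f \<in> C \<and> e \<noteq> f}"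
  have finS: "finite {(D, e, f) \<in> DD \<times> F \<times> F. e \<in> D \<and> f \<in> D \<and> e \<noteq> f}"
    "finite {(C, e, f) \<in> CC \<times> F \<times> F. e \<in> C \<and> f \<in> C \<and> e \<noteq> f}"
    by (rule finite_subset[of _ "DD \<times> F \<times> F"] finite_subset[of _ "CC \<times> F \<times> F"]; use CC DD F in auto)+
  have CC': "finite CC'" "\<And>C. C \<in> CC' \<Longrightarrow> circuit M C"
    using finS CC Cx DD by (auto simp: CC'_def)
  have DD': "finite DD'" "\<And>D. D \<in> DD' \<Longrightarrow> cocircuit M D"
    using finS DD Dx CC by (auto simp: DD'_def)
  have CxCC': "Cx D e f \<in> CC'" if "D \<in> DD" "e \<in> F" "f \<in> F" "e \<in> D" "f \<in> D" "e \<noteq> f" for D e f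
    unfolding CC'_def by (rule UnI2, rule image_eqI[of _ _ "(D, e, f)"]) (use that in auto)
  have DxDD': "Dx C e f \<in> DD'" if "C \<in> CC" "e \<in> F" "f \<in> F" "e \<in> C" "f \<in> C" "e \<noteq> f" for C e f
    unfolding DD'_def by (rule UnI2, rule image_eqI[of _ _ "(C, e, f)"]) (use that in auto)
  define G where "G = (\<Union>C\<in>CC'. \<Union>D\<in>DD'. C \<inter> D)"
  have G: "finite G" unfolding G_def
    by (intro finite_UN_I CC'(1) DD'(1)) (use tame CC'(2) DD'(2) in \<open>auto simp: tame_def\<close>)
  have FG: "F \<subseteq> G" unfolding F_def G_def CC'_def DD'_def by blast
  \<comment> \<open>A cocircuit of \<open>DD'\<close> meets the circuits of \<open>CC'\<close> only
    inside \<open>G\<close>. Contracting what they have outside \<open>G\<close> therefore leaves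
    all these cocircuits untouched.\<close>
  define P where "P = \<Union>CC' - G"
  have CCground: "\<Union>CC' \<subseteq> ground M" using circuitD(1)[OF M CC'(2)] by blast
  have P: "P \<subseteq> ground M" using CCground by (auto simp: P_def)
  have GP: "G \<subseteq> ground M - P" using CCground by (auto simp: P_def G_def)
  have CP: "C \<subseteq> G \<union> P" if "C \<in> CC'" for C using that by (auto simp: P_def)
  have DP: "D \<inter> P = {}" if "D \<in> DD'" for D using that by (auto simp: P_def G_def)
  let ?Q = "ground M - P - G"
  let ?N = "deletion (contraction M P) ?Q"
  have "minor_of ?N M" unfolding minor_of_def using P by (intro exI[of _ P] exI[of _ ?Q]) auto
  moreover have gN: "ground ?N = G" using GP by (auto simp: deletion_def ground_contraction[OF M])
  ultimately obtain v :: "'a \<Rightarrow> nat \<Rightarrow> 'k" where "represents fun_scale v ?N"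
    using rep G unfolding representable_def by metis
  then have "indep ?N = {I. I \<subseteq> G \<and> linindep_family fun_scale v I}"
    by (simp add: represents_def gN)
  moreover have "indep ?N = {I \<in> indep (contraction M P). I \<inter> ?Q = {}}"
    by (simp add: deletion_def)
  ultimately have v: "I \<in> indep (contraction M P) \<longleftrightarrow> linindep_family fun_scale v I" if "I \<subseteq> G" for I
    using that by blast
  note relation = circuit_relation[OF M P G GP v]
  note functional = cocircuit_functional[OF M P G GP v]
  have "\<exists>c. (\<forall>x\<in>C \<inter> F. c x \<noteq> 0) \<and> (\<forall>x. c x \<noteq> 0 \<longrightarrow> x \<in> C) \<and> (\<Sum>x\<in>G. fun_scale (c x) (v x)) = 0"
    if C: "C \<in> CC" for C
  proof (cases "C \<inter> F = {}")
    case True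
    then show ?thesis by (intro exI[of _ "\<lambda>_. 0"]) (simp add: fun_scale_def fun_eq_iff fun_scale_sum_apply[unfolded fun_scale_def])
  next
    case False
    then obtain e where e: "e \<in> C" "e \<in> F" by blast
    have CC'': "C \<in> CC'" using C by (simp add: CC'_def)
    obtain c where c: "c e = 1" "\<And>x. c x \<noteq> 0 \<Longrightarrow> x \<in> C \<inter> G" "(\<Sum>x\<in>G. fun_scale (c x) (v x)) = 0"
      using relation[OF _ CC'(2)[OF CC''] CP[OF CC''] e(1)] e(2) FG by blast
    have "c f \<noteq> 0" if f: "f \<in> C" "f \<in> F" for f
    proof
      assume cf: "c f = 0"
      with c(1) have ef: "e \<noteq> f" by auto
      \<comment> \<open>\<open>c\<close> and the functional of \<open>?D\<close> overlap at most in
        \<open>e\<close> and \<open>f\<close>; with \<open>c f = 0\<close> their vanishing pairing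
        reduces to the term at \<open>e\<close>, which is 1.\<close>
      let ?D = "Dx C e f"
      have D: "cocircuit M ?D" "C \<inter> ?D = {e, f}" "?D \<in> DD'"
        using Dx[OF CC(2)[OF C] e(1) f(1) ef] DxDD'[OF C e(2) f(2) e(1) f(1) ef] by auto
      have "e \<in> ?D" "e \<in> G" using D(2) e FG by blast+
      then obtain p where p: "p e = 1" "\<And>x. p x \<noteq> 0 \<Longrightarrow> x \<in> ?D \<inter> G" "(\<Sum>x\<in>G. c x * p x) = 0"
        using functional[OF _ D(1) DP[OF D(3)]] c(3) by blast
      have "(\<Sum>x\<in>G. c x * p x) = (\<Sum>x\<in>{e}. c x * p x)"
      proof (rule sum.mono_neutral_right[OF G])
        show "\<forall>x\<in>G - {e}. c x * p x = 0"
        proof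
          fix x assume "x \<in> G - {e}"
          then have "x = f \<or> x \<notin> C \<inter> ?D" using D(2) by blast
          then show "c x * p x = 0" using cf c(2)[of x] p(2)[of x] by auto
        qed
      qed (use \<open>e \<in> G\<close> in simp)
      with p(1,3) c(1) show False by simp
    qed
    with c show ?thesis by blast
  qed
  then obtain c where c: "\<And>C x. C \<in> CC \<Longrightarrow> x \<in> C \<Longrightarrow> x \<in> F \<Longrightarrow> c C x \<noteq> 0"
    "\<And>C x. C \<in> CC \<Longrightarrow> c C x \<noteq> 0 \<Longrightarrow> x \<in> C"
    "\<And>C. C \<in> CC \<Longrightarrow> (\<Sum>x\<in>G. fun_scale (c C x) (v x)) = 0"
    by (metis IntI)
  have "\<exists>d. (\<forall>x\<in>D \<inter> F. d x \<noteq> 0) \<and> (\<forall>x. d x \<noteq> 0 \<longrightarrow> x \<in> D) \<and>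
      (\<forall>l. (\<Sum>x\<in>G. fun_scale (l x) (v x)) = 0 \<longrightarrow> (\<Sum>x\<in>G. l x * d x) = 0)"
    if D: "D \<in> DD" for D
  proof (cases "D \<inter> F = {}")
    case True
    then show ?thesis by (intro exI[of _ "\<lambda>_. 0"]) simp
  next
    case False
    then obtain e where e: "e \<in> D" "e \<in> F" by blast
    have DD'': "D \<in> DD'" using D by (simp add: DD'_def)
    obtain d where d: "d e = 1" "\<And>x. d x \<noteq> 0 \<Longrightarrow> x \<in> D \<inter> G"
      "\<And>l. (\<Sum>x\<in>G. fun_scale (l x) (v x)) = 0 \<Longrightarrow> (\<Sum>x\<in>G. l x * d x) = 0"
      using functional[OF _ DD'(2)[OF DD''] DP[OF DD''] e(1)] e(2) FG by blast
    have "d f \<noteq> 0" if f: "f \<in> D" "f \<in> F" for f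
    proof
      assume df: "d f = 0"
      with d(1) have ef: "e \<noteq> f" by auto
      let ?C = "Cx D e f"
      have C: "circuit M ?C" "?C \<inter> D = {e, f}" "?C \<in> CC'"
        using Cx[OF DD(2)[OF D] e(1) f(1) ef] CxCC'[OF D e(2) f(2) e(1) f(1) ef] by auto
      have "e \<in> ?C" "e \<in> G" using C(2) e FG by blast+
      then obtain l where l: "l e = 1" "\<And>x. l x \<noteq> 0 \<Longrightarrow> x \<in> ?C \<inter> G" "(\<Sum>x\<in>G. fun_scale (l x) (v x)) = 0"
        using relation[OF _ C(1) CP[OF C(3)]] by blast
      have "(\<Sum>x\<in>G. l x * d x) = (\<Sum>x\<in>{e}. l x * d x)"
      proof (rule sum.mono_neutral_right[OF G])
        show "\<forall>x\<in>G - {e}. l x * d x = 0"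
        proof
          fix x assume "x \<in> G - {e}"
          then have "x = f \<or> x \<notin> ?C \<inter> D" using C(2) by blast
          then show "l x * d x = 0" using df d(2)[of x] l(2)[of x] by auto
        qed
      qed (use \<open>e \<in> G\<close> in simp)
      with d(1) d(3)[OF l(3)] l(1) show False by simp
    qed
    with d show ?thesis by blast
  qed
  from bchoice[OF ballI, OF this, of DD "\<lambda>D. D"]
  obtain d where d: "\<And>D x. D \<in> DD \<Longrightarrow> x \<in> D \<Longrightarrow> x \<in> F \<Longrightarrow> d D x \<noteq> 0"
    "\<And>D x. D \<in> DD \<Longrightarrow> d D x \<noteq> 0 \<Longrightarrow> x \<in> D"
    "\<And>D l. D \<in> DD \<Longrightarrow> (\<Sum>x\<in>G. fun_scale (l x) (v x)) = 0 \<Longrightarrow> (\<Sum>x\<in>G. l x * d D x) = 0"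
    by fastforce
  show ?thesis
  \<comment> \<open>Zeros become 1 to obtain weights that vanish nowhere. This is harmless, since on
    \<open>C \<inter> D\<close>, a subset of \<open>F\<close>, there are no zeros to
    replace.\<close>
  proof (rule that[of "\<lambda>C x. if c C x = 0 then 1 else c C x" "\<lambda>D x. if d D x = 0 then 1 else d D x"])
    fix C D assume CD: "C \<in> CC" "D \<in> DD"
    have sub: "C \<inter> D \<subseteq> F" using CD by (auto simp: F_def)
    have "(\<Sum>x\<in>C \<inter> D. (if c C x = 0 then 1 else c C x) * (if d D x = 0 then 1 else d D x)) =
        (\<Sum>x\<in>C \<inter> D. c C x * d D x)"
      by (rule sum.cong) (use c(1)[OF CD(1)] d(1)[OF CD(2)] sub in auto)
    also have "\<dots> = (\<Sum>x\<in>G. c C x * d D x)"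
      by (rule sum.mono_neutral_left[OF G]) (use sub FG c(2)[OF CD(1)] d(2)[OF CD(2)] in auto)
    also have "\<dots> = 0" by (rule d(3)[OF CD(2) c(3)[OF CD(1)]])
    finally show "(\<Sum>x\<in>C \<inter> D. (if c C x = 0 then 1 else c C x) * (if d D x = 0 then 1 else d D x)) = 0" .
  qed auto
qed

lemma painting_if_finite_minors_representable:
  fixes M :: "'a indep_system"
  assumes M: "matroid M" and tame: "tame M"
    and rep: "\<forall>N. minor_of N M \<and> finite (ground N) \<longrightarrow> representable TYPE('k::{field,finite}) N"
  obtains c d :: "'a set \<Rightarrow> 'a \<Rightarrow> 'k::{field,finite}" where "painting M c d"
proof -
  \<comment> \<open>The sum type joins circuit weights (\<open>Inl\<close>) and cocircuit weights
    (\<open>Inr\<close>) in one point of a product space; each pair contributes one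
    constraint.\<close>
  define Z where "Z = (\<lambda>(C, D). {g :: 'a set \<times> 'a + 'a set \<times> 'a \<Rightarrow> 'k. (\<forall>x. g x \<noteq> 0) \<and>
      (circuit M C \<longrightarrow> cocircuit M D \<longrightarrow> (\<Sum>e\<in>C \<inter> D. g (Inl (C, e)) * g (Inr (D, e))) = 0)})"
  have "(\<Inter>i. Z i) \<noteq> {}"
  proof (rule finite_range_compactness)
    fix i g assume g: "g \<notin> Z i"
    obtain C D where i: "i = (C, D)" by fastforce
    show "\<exists>J. finite J \<and> (\<forall>h. (\<forall>x\<in>J. h x = g x) \<longrightarrow> h \<notin> Z i)"
    proof (cases "\<exists>x. g x = 0")
      case True
      then obtain x where "g x = 0" by blast
      then show ?thesis by (intro exI[of _ "{x}"]) (auto simp: Z_def i)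
    next
      case False
      with g have CD: "circuit M C" "cocircuit M D"
        "(\<Sum>e\<in>C \<inter> D. g (Inl (C, e)) * g (Inr (D, e))) \<noteq> 0" by (auto simp: Z_def i)
      \<comment> \<open>Tameness makes this finite, so violating one orthogonality condition is an
        open property.\<close>
      let ?J = "(\<lambda>e. Inl (C, e)) ` (C \<inter> D) \<union> (\<lambda>e. Inr (D, e)) ` (C \<inter> D)"
      have "finite (C \<inter> D)" using tame CD by (simp add: tame_def)
      moreover have "h \<notin> Z i" if h: "\<forall>x\<in>?J. h x = g x" for h
      proof -
        have "(\<Sum>e\<in>C \<inter> D. h (Inl (C, e)) * h (Inr (D, e))) = (\<Sum>e\<in>C \<inter> D. g (Inl (C, e)) * g (Inr (D, e)))"
          by (rule sum.cong) (use h in auto)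
        with CD show ?thesis by (auto simp: Z_def i)
      qed
      ultimately show ?thesis by (intro exI[of _ ?J]) auto
    qed
  next
    fix W :: "('a set \<times> 'a set) set" assume W: "finite W"
    obtain c d :: "'a set \<Rightarrow> 'a \<Rightarrow> 'k" where cd: "\<And>C e. c C e \<noteq> 0" "\<And>D e. d D e \<noteq> 0"
      "\<And>C D. C \<in> {C \<in> fst ` W. circuit M C} \<Longrightarrow> D \<in> {D \<in> snd ` W. cocircuit M D} \<Longrightarrow>
        (\<Sum>e\<in>C \<inter> D. c C e * d D e) = 0"
      by (rule finite_painting[OF M tame rep, of "{C \<in> fst ` W. circuit M C}" "{D \<in> snd ` W. cocircuit M D}"])
        (use W in auto)
    let ?g = "\<lambda>x. case x of Inl (C, e) \<Rightarrow> c C e | Inr (D, e) \<Rightarrow> d D e"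
    have "?g x \<noteq> 0" for x using cd(1,2) by (auto split: sum.split prod.split)
    then have "?g \<in> Z i" if "i \<in> W" for i
      using that cd(3)[of "fst i" "snd i"] by (auto simp: Z_def split: prod.split)
    then show "(\<Inter>i\<in>W. Z i) \<noteq> {}" by blast
  qed
  then obtain g where g: "\<And>i. g \<in> Z i" by blast
  have "g x \<noteq> 0" for x using g[of "({}, {})"] by (auto simp: Z_def)
  moreover have "(\<Sum>e\<in>C \<inter> D. g (Inl (C, e)) * g (Inr (D, e))) = 0" if "circuit M C" "cocircuit M D" for C D
    using g[of "(C, D)"] that by (auto simp: Z_def)
  ultimately have "painting M (\<lambda>C e. g (Inl (C, e))) (\<lambda>D e. g (Inr (D, e)))"
    by (auto simp: painting_def)
  with that show ?thesis .
qed

theorem theorem1p1: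
  fixes M :: "'a indep_system"
  assumes "matroid M" and "tame M"
  shows "thin_sums_matroid TYPE('k::{field,finite}) M \<longleftrightarrow>
    (\<forall>N. minor_of N M \<and> finite (ground N) \<longrightarrow> representable TYPE('k) N)"
proof (intro iffI allI impI)
  fix N assume "thin_sums_matroid TYPE('k) M" and N: "minor_of N M \<and> finite (ground N)"
  then obtain c d :: "'a set \<Rightarrow> 'a \<Rightarrow> 'k" where "painting M c d"
    using painting_if_thin_sums_matroid[OF _ assms(2)] by blast
  then show "representable TYPE('k) N"
    by (rule representable_minor_if_painting[OF assms(1)]) (use N in auto)
next
  assume "\<forall>N. minor_of N M \<and> finite (ground N) \<longrightarrow> representable TYPE('k) N"
  then obtain c d :: "'a set \<Rightarrow> 'a \<Rightarrow> 'k" where "painting M c d"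
    using painting_if_finite_minors_representable[OF assms] by blast
  then show "thin_sums_matroid TYPE('k) M"
    by (rule thin_sums_matroid_if_painting[OF assms])
qed

end
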